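(* Let $\Omega\subset\mathbb{R}^N$ be open and bounded. (1) Let $(J_n)_{n\in\mathbb{N}}$ be a sequence of convex functionals in $GC(\Omega)$ such that there exists a functional $\tilde J$ defined on characteristic functions of Borel subsets of $\Omega$ satisfying: (a) for every Borel set $E\subseteq\Omega$ and every sequence of Borel sets $(E_n)_{n\in\mathbb{N}}$ contained in $\Omega$ such that $\chi_{E_n}\to\chi_E$ in $L^1(\Omega)$, $$\tilde J(\chi_E)\le\liminf_{n\to\infty}J_n(\chi_{E_n});$$ (b) for every Borel set $E\subseteq\Omega$ there exists a sequence of Borel sets $(E_n)_{n\in\mathbb{N}}$ contained in $\Omega$ with $\chi_{E_n}\to\chi_E$ in $L^1(\Omega)$ and $$\limsup_{n\to\infty}J_n(\chi_{E_n})\le\tilde J(\chi_E).$$ Then, setting $J(u):=\int_{-\infty}^{+\infty}\tilde J(\chi_{\{u>s\}})\,ds$ for $u\in L^1(\Omega)$, we have $J\in GC(\Omega)$ and the sequence $(J_n)_{n\in\mathbb{N}}$ $\Gamma$-converges to $J$ in the $L^1(\Omega)$-topology. (2) Conversely, let $(J_n)_{n\in\mathbb{N}}$ be a sequence of functionals in $GC(\Omega)$ which $\Gamma$-converges (in the $L^1(\Omega)$-topology) to a proper functional $J:L^1(\Omega)\to[0,+\infty]$. Then $J\in GC(\Omega)$ and its restriction $\tilde J$ to the family of characteristic functions of Borel subsets of $\Omega$ satisfies conditions (a) and (b).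
   Context: A functional $J:L^1(\Omega)\to[0,+\infty]$ is proper if it is not identically $+\infty$. $GC(\Omega)$ denotes the class of proper functionals $J:L^1(\Omega)\to[0,+\infty]$ satisfying the generalized coarea formula: for every $u\in L^1(\Omega)$, $$J(u)=\int_{-\infty}^{+\infty}J(\chi_{\{u>s\}})\,ds,$$ with the convention $J(u)=+\infty$ if the map $s\mapsto J(\chi_{\{u>s\}})$ is not measurable. A sequence $(J_n)$ $\Gamma$-converges to $J$ in the $L^1(\Omega)$-topology if for every $u\in L^1(\Omega)$: (i) $\liminf_n J_n(u_n)\ge J(u)$ for every sequence $u_n\to u$ in $L^1(\Omega)$; (ii) there is a sequence $u_n\to u$ in $L^1(\Omega)$ with $\limsup_n J_n(u_n)\le J(u)$.
   Formalization: In (2), the conclusion J ∈ GC(Ω) is stated only when all J_n are convex, as in (1); without convexity it is false (a Γ-limit of non-convex functionals in GC(Ω) can violate the coarea formula). Conditions (a) and (b) in (2) are stated without convexity. *)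

theory Defs
  imports "HOL-Analysis.Analysis"
begin

text \<open>Elements of \<open>L\<^sup>1(\<Omega>)\<close> are represented by Borel functions that are integrable on \<open>\<Omega>\<close>; their
  values outside \<open>\<Omega>\<close> are irrelevant. Functionals on \<open>L\<^sup>1(\<Omega>)\<close> are functionals on
  representatives that do not distinguish functions agreeing almost everywhere in \<open>\<Omega>\<close>. Using Borel
  representatives, all superlevel sets in \<open>\<Omega>\<close> are Borel sets.\<close>

definition L1 :: "(real ^ 'n) set \<Rightarrow> (real ^ 'n \<Rightarrow> real) set" where
  "L1 \<Omega> = {u. set_integrable lborel \<Omega> u}"

definition L1_functional :: "(real ^ 'n) set \<Rightarrow> ((real ^ 'n \<Rightarrow> real) \<Rightarrow> ennreal) \<Rightarrow> bool" where
  "L1_functional \<Omega> J \<longleftrightarrow>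
    (\<forall>u\<in>L1 \<Omega>. \<forall>v\<in>L1 \<Omega>. (AE x\<in>\<Omega> in lborel. u x = v x) \<longrightarrow> J u = J v)"

definition L1_converges ::
  "(real ^ 'n) set \<Rightarrow> (nat \<Rightarrow> real ^ 'n \<Rightarrow> real) \<Rightarrow> (real ^ 'n \<Rightarrow> real) \<Rightarrow> bool" where
  "L1_converges \<Omega> un u \<longleftrightarrow>
    (\<forall>n. un n \<in> L1 \<Omega>) \<and> u \<in> L1 \<Omega> \<and>
    (\<lambda>n. LINT x:\<Omega>|lborel. \<bar>un n x - u x\<bar>) \<longlonglongrightarrow> 0"

definition proper_functional :: "(real ^ 'n) set \<Rightarrow> ((real ^ 'n \<Rightarrow> real) \<Rightarrow> ennreal) \<Rightarrow> bool" where
  "proper_functional \<Omega> J \<longleftrightarrow> (\<exists>u\<in>L1 \<Omega>. J u \<noteq> \<infinity>)"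

text \<open>At \<open>t = 0\<close> and \<open>t = 1\<close> the convention \<open>0 * \<infinity> = 0\<close> of type \<open>ennreal\<close> makes the
  inequality trivial, as it should be.\<close>

definition convex_functional :: "(real ^ 'n) set \<Rightarrow> ((real ^ 'n \<Rightarrow> real) \<Rightarrow> ennreal) \<Rightarrow> bool" where
  "convex_functional \<Omega> J \<longleftrightarrow>
    (\<forall>u\<in>L1 \<Omega>. \<forall>v\<in>L1 \<Omega>. \<forall>t\<in>{0..1}.
       J (\<lambda>x. t * u x + (1 - t) * v x) \<le> ennreal t * J u + ennreal (1 - t) * J v)"

text \<open>\<open>F\<close> is evaluated at characteristic functions of Borel subsets of \<open>\<Omega>\<close> only, so \<open>F\<close> may also
  be a functional which is meaningful just on these. Measurability in \<open>s\<close> is Lebesgue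
  measurability.\<close>

definition coarea_integral ::
  "(real ^ 'n) set \<Rightarrow> ((real ^ 'n \<Rightarrow> real) \<Rightarrow> ennreal) \<Rightarrow> (real ^ 'n \<Rightarrow> real) \<Rightarrow> ennreal" where
  "coarea_integral \<Omega> F u =
    (if (\<lambda>s::real. F (indicator {x\<in>\<Omega>. u x > s})) \<in> borel_measurable lebesgue
     then \<integral>\<^sup>+ s. F (indicator {x\<in>\<Omega>. u x > s}) \<partial>lebesgue
     else \<infinity>)"

definition GC :: "(real ^ 'n) set \<Rightarrow> ((real ^ 'n \<Rightarrow> real) \<Rightarrow> ennreal) set" where
  "GC \<Omega> = {J. L1_functional \<Omega> J \<and> proper_functional \<Omega> J \<and>
               (\<forall>u\<in>L1 \<Omega>. J u = coarea_integral \<Omega> J u)}"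

definition Gamma_converges ::
  "(real ^ 'n) set \<Rightarrow> (nat \<Rightarrow> (real ^ 'n \<Rightarrow> real) \<Rightarrow> ennreal) \<Rightarrow>
   ((real ^ 'n \<Rightarrow> real) \<Rightarrow> ennreal) \<Rightarrow> bool" where
  "Gamma_converges \<Omega> Jn J \<longleftrightarrow>
    (\<forall>u\<in>L1 \<Omega>.
       (\<forall>un. L1_converges \<Omega> un u \<longrightarrow> J u \<le> liminf (\<lambda>n. Jn n (un n))) \<and>
       (\<exists>un. L1_converges \<Omega> un u \<and> limsup (\<lambda>n. Jn n (un n)) \<le> J u))"

definition liminf_on_sets ::
  "(real ^ 'n) set \<Rightarrow> (nat \<Rightarrow> (real ^ 'n \<Rightarrow> real) \<Rightarrow> ennreal) \<Rightarrow>
   ((real ^ 'n \<Rightarrow> real) \<Rightarrow> ennreal) \<Rightarrow> bool" where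
  "liminf_on_sets \<Omega> Jn F \<longleftrightarrow>
    (\<forall>E En. E \<in> sets borel \<and> E \<subseteq> \<Omega> \<and> (\<forall>n. En n \<in> sets borel \<and> En n \<subseteq> \<Omega>) \<and>
       L1_converges \<Omega> (\<lambda>n. indicator (En n)) (indicator E) \<longrightarrow>
       F (indicator E) \<le> liminf (\<lambda>n. Jn n (indicator (En n))))"

definition recovery_on_sets ::
  "(real ^ 'n) set \<Rightarrow> (nat \<Rightarrow> (real ^ 'n \<Rightarrow> real) \<Rightarrow> ennreal) \<Rightarrow>
   ((real ^ 'n \<Rightarrow> real) \<Rightarrow> ennreal) \<Rightarrow> bool" where
  "recovery_on_sets \<Omega> Jn F \<longleftrightarrow>
    (\<forall>E. E \<in> sets borel \<and> E \<subseteq> \<Omega> \<longrightarrow>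
       (\<exists>En. (\<forall>n. En n \<in> sets borel \<and> En n \<subseteq> \<Omega>) \<and>
          L1_converges \<Omega> (\<lambda>n. indicator (En n)) (indicator E) \<and>
          limsup (\<lambda>n. Jn n (indicator (En n))) \<le> F (indicator E)))"

end

theory Submission
  imports Defs
begin

text \<open>If \<open>u\<^sub>n\<close> converges to \<open>u\<close> in \<open>L\<^sup>1\<close>, then by Markov's inequality the superlevel sets at
  height \<open>s\<close> converge for every \<open>s\<close> with \<open>|{u = s}| = 0\<close>, that is, for all but countably many \<open>s\<close>.
  Conditions (a) and (b) make the limit on sets lower semicontinuous (by a diagonal argument), so
  its values along the superlevel sets of \<open>u\<close> form a function of \<open>s\<close> that is lower semicontinuous
  off a countable set, hence Borel. The liminf inequality is then Fatou's lemma. For the limsup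
  inequality, \<open>u\<close> is truncated and replaced by a staircase \<open>a + \<delta> \<Sum> \<chi>{u > s\<^sub>i}\<close>, each \<open>s\<^sub>i\<close> being chosen
  in its slice such that the value there is at most the average over the slice; a convex
  functional with the coarea formula is subadditive and positively homogeneous, so recovery
  sequences of the finitely many sets add up. Conversely, a recovery sequence of functions for
  \<open>\<chi>\<^sub>E\<close> yields one of sets by cutting each function at a good level away from 0 and 1; that the limit
  satisfies the coarea formula follows from the first part and uniqueness of limits.\<close>

section \<open>Sequences and integrals\<close>

text \<open>At index \<open>n\<close> the diagonal follows the row with the largest \<open>k\<close>
  whose threshold \<open>N k\<close> has been passed. That row number eventually exceeds any given
  \<open>k\<close>, and \<open>anti\<close> brings the property back down to
  \<open>k\<close>.\<close>

lemma eventually_diagonal: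
  assumes ex: "\<And>k. \<exists>x. (\<forall>n. x n \<in> S) \<and> (\<forall>\<^sub>F n in sequentially. P k n (x n))"
    and anti: "\<And>j k n y. j \<le> k \<Longrightarrow> P k n y \<Longrightarrow> P j n y"
  shows "\<exists>y. (\<forall>n::nat. y n \<in> S) \<and> (\<forall>k::nat. \<forall>\<^sub>F n in sequentially. P k n (y n))"
proof -
  obtain x where xS: "\<And>k n. x k n \<in> S" and ev: "\<And>k. \<forall>\<^sub>F n in sequentially. P k n (x k n)"
    using ex by metis
  obtain N where N: "\<And>k n. n \<ge> N k \<Longrightarrow> P k n (x k n)"
    using ev unfolding eventually_sequentially by metis
  \<comment> \<open>The bound \<open>k \<le> n\<close> makes the maximum exist even if
    \<open>N\<close> is bounded. The default 0 is never met in the claim, where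
    \<open>n \<ge> max k (N k)\<close>.\<close>
  define m where "m n = (if \<exists>k\<le>n. N k \<le> n then GREATEST k. k \<le> n \<and> N k \<le> n else 0)" for n
  have "P k n (x (m n) n)" if "n \<ge> max k (N k)" for k n
  proof -
    have k: "k \<le> n \<and> N k \<le> n" using that by simp
    then have "\<exists>k\<le>n. N k \<le> n" by blast
    then have m: "m n = (GREATEST k. k \<le> n \<and> N k \<le> n)" unfolding m_def by simp
    have "k \<le> m n" unfolding m by (rule Greatest_le_nat[where b=n]) (use k in auto)
    moreover have "N (m n) \<le> n"
      unfolding m using GreatestI_nat[where P="\<lambda>k. k \<le> n \<and> N k \<le> n" and b=n and k=k] k by auto
    ultimately show ?thesis using N anti by blast
  qed
  then have "\<forall>\<^sub>F n in sequentially. P k n (x (m n) n)" for k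
    unfolding eventually_sequentially by blast
  with xS show ?thesis by (intro exI[of _ "\<lambda>n. x (m n) n"]) auto
qed

lemma eventually_le_limsup_plus:
  fixes f :: "nat \<Rightarrow> ennreal"
  assumes "limsup f \<le> B" "e > 0"
  shows "\<forall>\<^sub>F n in sequentially. f n \<le> B + ennreal e"
proof (cases "B = \<infinity>")
  case False
  then have "B < B + ennreal e"
    using assms(2) by (cases B) (auto simp: ennreal_plus[symmetric] ennreal_less_iff simp del: ennreal_plus)
  with assms(1) have "limsup f < B + ennreal e" by (rule le_less_trans)
  then show ?thesis by (auto dest!: Limsup_lessD elim: eventually_mono)
qed simp

lemma limsup_le_of_eventually_plus:
  fixes f :: "nat \<Rightarrow> ennreal"
  assumes "\<And>e. e > 0 \<Longrightarrow> \<forall>\<^sub>F n in sequentially. f n \<le> B + ennreal e"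
  shows "limsup f \<le> B"
proof (rule ennreal_le_epsilon)
  fix e :: real assume "0 < e"
  from assms[OF this] show "limsup f \<le> B + ennreal e" by (rule Limsup_bounded)
qed

section \<open>Choice of good points by averaging\<close>

lemma exists_less_if_nn_integral_less:
  assumes "S \<in> sets M" "(\<integral>\<^sup>+x\<in>S. g x \<partial>M) < c * emeasure M S"
  shows "\<exists>s\<in>S. g s < (c::ennreal)"
proof (rule ccontr)
  assume "\<not> (\<exists>s\<in>S. g s < c)"
  then have "(\<integral>\<^sup>+x. c * indicator S x \<partial>M) \<le> (\<integral>\<^sup>+x\<in>S. g x \<partial>M)"
    by (intro nn_integral_mono) (auto split: split_indicator simp: not_less)
  with assms show False by (simp add: nn_integral_cmult_indicator)
qed

text \<open>If \<open>g\<close> exceeded its mean \<open>h\<close> everywhere on \<open>S\<close>,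
  its integral over \<open>S\<close> would be strictly larger than \<open>h * r\<close>, which is
  that integral itself. The strict comparison needs a finite integral, and the negated claim
  supplies it.\<close>

lemma exists_le_average:
  fixes g :: "'a \<Rightarrow> ennreal"
  assumes g: "g \<in> borel_measurable M" and S: "S \<in> sets M" "emeasure M S = ennreal r" "r > 0"
  shows "\<exists>s\<in>S. ennreal r * g s \<le> (\<integral>\<^sup>+x\<in>S. g x \<partial>M)"
proof (rule ccontr)
  let ?c = "\<integral>\<^sup>+x\<in>S. g x \<partial>M"
  assume "\<not> ?thesis"
  then have less: "?c < ennreal r * g s" if "s \<in> S" for s using that by (auto simp: not_le)
  have "S \<noteq> {}" using S by auto
  then obtain s where "s \<in> S" by blast
  from less[OF this] have "?c < \<infinity>" using top_greatest unfolding infinity_ennreal_def by (rule less_le_trans)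
  define h where "h = ?c / ennreal r"
  have h: "h * ennreal r = ?c"
    unfolding h_def using S(3) by (simp add: ennreal_divide_times ennreal_mult_divide_eq)
  have gh: "h < g s" if "s \<in> S" for s
  proof (rule ccontr)
    assume "\<not> h < g s"
    then have "ennreal r * g s \<le> ennreal r * h" by (intro mult_left_mono) auto
    with less[OF that] h show False by (simp add: mult.commute)
  qed
  have "(\<integral>\<^sup>+x. h * indicator S x \<partial>M) < (\<integral>\<^sup>+x\<in>S. g x \<partial>M)"
  proof (rule nn_integral_less)
    show "(\<integral>\<^sup>+x. h * indicator S x \<partial>M) \<noteq> \<infinity>"
      using S h \<open>?c < \<infinity>\<close> by (simp add: nn_integral_cmult_indicator)
    show "AE x in M. h * indicator S x \<le> g x * indicator S x"
      using gh by (intro AE_I2) (auto split: split_indicator intro: less_imp_le)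
    show "\<not> (AE x in M. g x * indicator S x \<le> h * indicator S x)"
    proof
      assume "AE x in M. g x * indicator S x \<le> h * indicator S x"
      then have "AE x in M. x \<notin> S"
        by eventually_elim (use gh in \<open>force split: split_indicator_asm simp: not_le\<close>)
      then have "emeasure M S = 0" using AE_iff_measurable[OF S(1), of "\<lambda>x. x \<notin> S"] sets.sets_into_space[OF S(1)] by auto
      with S show False by simp
    qed
  qed (use g S in auto)
  with h S show False by (simp add: nn_integral_cmult_indicator)
qed

text \<open>\<open>A\<close> is its interior together with a subset of \<open>D\<close>. This is
  meant for strict superlevel sets of functions that are lower semicontinuous off
  \<open>D\<close>.\<close>

lemma open_Un_countable_borel:
  fixes A :: "real set"
  assumes "countable D" and nb: "\<And>s. s \<in> A \<Longrightarrow> s \<notin> D \<Longrightarrow> \<exists>U. open U \<and> s \<in> U \<and> U \<subseteq> A"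
  shows "A \<in> sets borel"
proof -
  have "s \<in> interior A \<union> (A \<inter> D)" if "s \<in> A" for s
    using nb[OF that] that interiorI by blast
  then have "A = interior A \<union> (A \<inter> D)"
    using interior_subset[of A] by blast
  moreover have "A \<inter> D \<in> sets borel"
    by (rule sets.countable) (use assms(1) in \<open>simp_all add: countable_Int2\<close>)
  ultimately show ?thesis by (metis borel_open open_interior sets.Un)
qed

text \<open>If \<open>y\<close> lies in slice \<open>p\<close>, the levels of the slices before
  \<open>p\<close> are below \<open>y\<close> and those of the slices after \<open>p\<close> are
  above it; only \<open>s p\<close> is undecided. So the sum counts \<open>p\<close> or
  \<open>p + 1\<close> steps of height \<delta>.\<close>

lemma staircase_approx:
  fixes y a \<delta> :: real
  assumes "\<delta> > 0" "a \<le> y" "y \<le> a + real K * \<delta>"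
    and s: "\<And>i. i < K \<Longrightarrow> a + real i * \<delta> < s i \<and> s i < a + real (Suc i) * \<delta>"
  shows "\<bar>a + (\<Sum>i<K. \<delta> * (if s i < y then 1 else 0)) - y\<bar> \<le> \<delta>"
proof -
  define p where "p = nat \<lfloor>(y - a) / \<delta>\<rfloor>"
  have p0: "0 \<le> \<lfloor>(y - a) / \<delta>\<rfloor>" using assms by simp
  have p1: "real p \<le> (y - a) / \<delta>" "(y - a) / \<delta> < real p + 1"
    unfolding p_def using p0 by (auto simp: of_nat_nat) 
  then have p: "real p * \<delta> \<le> y - a" "y - a < (real p + 1) * \<delta>"
    using assms(1) by (auto simp: field_simps)
  let ?S = "{i. i < K \<and> s i < y}"
  \<comment> \<open>Equality \<open>p = K\<close> occurs only at the upper end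
    \<open>y = a + K * \<delta>\<close>, where every level lies below \<open>y\<close>.\<close>
  have "real p * \<delta> \<le> real K * \<delta>" using p(1) assms(3) by linarith
  then have "p \<le> K" using assms(1) by simp
  have "{..<p} \<subseteq> ?S"
  proof
    fix i assume "i \<in> {..<p}"
    then have i: "i < p" by simp
    then have "real (Suc i) * \<delta> \<le> real p * \<delta>" using assms(1) by (intro mult_right_mono) auto
    with s[of i] i \<open>p \<le> K\<close> p show "i \<in> ?S" by auto
  qed
  moreover have "?S \<subseteq> {..p}"
  proof
    fix i assume i: "i \<in> ?S"
    show "i \<in> {..p}"
    proof (rule ccontr)
      assume "i \<notin> {..p}"
      then have "(real p + 1) * \<delta> \<le> real i * \<delta>" using assms(1) by (intro mult_right_mono) auto
      with s[of i] i p show False by auto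
    qed
  qed
  ultimately have c: "p \<le> card ?S" "card ?S \<le> Suc p"
    using card_mono[of ?S "{..<p}"] card_mono[of "{..p}" ?S] by auto
  have "(\<Sum>i<K. \<delta> * (if s i < y then 1 else 0)) = \<delta> * real (card ?S)"
    by (simp add: sum_distrib_left[symmetric] sum.If_cases Collect_conj_eq[symmetric] lessThan_def Int_def)
  moreover define C where "C = \<delta> * real (card ?S)"
  moreover have "\<delta> * real p \<le> \<delta> * real (card ?S)" "\<delta> * real (card ?S) \<le> \<delta> * (real p + 1)"
    by (rule mult_left_mono; use c assms(1) in simp)+
  ultimately have "\<delta> * real p \<le> C" "C \<le> \<delta> * (real p + 1)"
    "(\<Sum>i<K. \<delta> * (if s i < y then 1 else 0)) = C" by simp_all
  then show ?thesis using p unfolding abs_le_iff by (simp add: algebra_simps)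
qed

lemma emeasure_lborel_halfline:
  "emeasure lborel {r::real..} = \<infinity>" "emeasure lborel {..r} = \<infinity>"
proof -
  have top: "emeasure lborel A = \<infinity>"
    if "A \<in> sets borel" and I: "\<And>n. \<exists>a. {a..a + real n} \<subseteq> A" for A
  proof (rule ccontr)
    assume "emeasure lborel A \<noteq> \<infinity>"
    then obtain n where n: "emeasure lborel A < of_nat n"
      using ennreal_Ex_less_of_nat[of "emeasure lborel A"] by (auto simp: less_top)
    obtain a where "{a..a + real n} \<subseteq> A" using I by blast
    then have "emeasure lborel {a..a + real n} \<le> emeasure lborel A"
      using that(1) by (intro emeasure_mono) auto
    with n show False by (simp add: ennreal_of_nat_eq_real_of_nat)
  qed
  have "{r..r + real n} \<subseteq> {r..}" "{r - real n..r - real n + real n} \<subseteq> {..r}" for n by auto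
  then show "emeasure lborel {r..} = \<infinity>" "emeasure lborel {..r} = \<infinity>"
    by (blast intro!: top borel_closed closed_atLeast closed_atMost)+
qed

text \<open>In each of \<open>K\<close> disjoint slices of length \<delta> a level is taken at which
  \<delta> times the value is at most the integral over that slice. By disjointness the slice
  integrals add up to at most the whole integral.\<close>

lemma exists_slice_levels:
  fixes g :: "real \<Rightarrow> ennreal"
  assumes g: "g \<in> borel_measurable lebesgue" and "\<delta> > 0"
  shows "\<exists>s. (\<forall>i<K. a + real i * \<delta> < s i \<and> s i < a + real (Suc i) * \<delta>) \<and>
    (\<Sum>i<K. ennreal \<delta> * g (s i)) \<le> (\<integral>\<^sup>+x. g x \<partial>lebesgue)"
proof -
  define I where "I i = {a + real i * \<delta><..<a + real (Suc i) * \<delta>}" for i :: nat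
  have "\<exists>s\<in>I i. ennreal \<delta> * g s \<le> (\<integral>\<^sup>+x\<in>I i. g x \<partial>lebesgue)" for i
    using assms by (intro exists_le_average) (auto simp: I_def algebra_simps)
  then obtain s where s: "\<And>i. s i \<in> I i" "\<And>i. ennreal \<delta> * g (s i) \<le> (\<integral>\<^sup>+x\<in>I i. g x \<partial>lebesgue)"
    by metis
  have disj: "I i \<inter> I j = {}" if "i < j" for i j
  proof -
    have "real (Suc i) * \<delta> \<le> real j * \<delta>" using that assms(2) by (intro mult_right_mono) auto
    then show ?thesis unfolding I_def by auto
  qed
  have "disjoint_family_on I {..<K}"
    unfolding disjoint_family_on_def using disj by (metis Int_commute linorder_neqE_nat)
  then have ind: "(\<Sum>i<K. indicator (I i) x :: ennreal) = indicator (\<Union>(I ` {..<K})) x" for x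
    by (intro indicator_UN_disjoint[symmetric]) auto
  have "(\<Sum>i<K. ennreal \<delta> * g (s i)) \<le> (\<Sum>i<K. \<integral>\<^sup>+x\<in>I i. g x \<partial>lebesgue)"
    by (intro sum_mono s(2))
  also have "\<dots> = (\<integral>\<^sup>+x. (\<Sum>i<K. g x * indicator (I i) x) \<partial>lebesgue)"
    using g by (intro nn_integral_sum[symmetric] borel_measurable_times_ennreal borel_measurable_indicator)
      (auto simp: I_def)
  also have "\<dots> \<le> (\<integral>\<^sup>+x. g x \<partial>lebesgue)"
    by (intro nn_integral_mono) (simp add: sum_distrib_left[symmetric] ind split: split_indicator)
  finally show ?thesis using s(1) by (intro exI[of _ s]) (auto simp: I_def)
qed

section \<open>Superlevel sets and the distance of $L^1$\<close>

locale bounded_open_set =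
  fixes \<Omega> :: "(real ^ 'n) set"
  assumes open_\<Omega>: "open \<Omega>" and bounded_\<Omega>: "bounded \<Omega>"
begin

text \<open>Over \<open>M\<close> the set integrals of the definitions become ordinary integrals on
  a finite measure space, whose measurable sets are exactly the Borel subsets of \<Omega>.\<close>

abbreviation M where "M \<equiv> restrict_space lborel \<Omega>"

lemma sets_M: "A \<in> sets M \<longleftrightarrow> A \<in> sets borel \<and> A \<subseteq> \<Omega>"
  using open_\<Omega> by (subst sets_restrict_space_iff) auto

lemma space_M [simp]: "space M = \<Omega>"
  by (simp add: space_restrict_space)

lemma finite_measure_M: "finite_measure M"
proof
  have "emeasure lborel \<Omega> < \<infinity>" using bounded_\<Omega> by (rule emeasure_bounded_finite)
  then show "emeasure M (space M) \<noteq> \<infinity>"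
    using open_\<Omega> by (subst emeasure_restrict_space) auto
qed

sublocale finite_measure M by (rule finite_measure_M)

lemma L1_iff: "u \<in> L1 \<Omega> \<longleftrightarrow> integrable M u"
  using open_\<Omega> by (simp add: L1_def set_integrable_def integrable_restrict_space)

lemma measurable_L1: "u \<in> L1 \<Omega> \<Longrightarrow> u \<in> borel_measurable M"
  by (simp add: L1_iff)

lemma indicator_L1: "E \<in> sets M \<Longrightarrow> indicator E \<in> L1 \<Omega>"
  unfolding L1_iff using sets.Int_space_eq2[of E M]
  by (subst integrable_indicator_iff) (auto simp: less_top[symmetric])

lemma superlevel_sets: "u \<in> L1 \<Omega> \<Longrightarrow> {x\<in>\<Omega>. u x > s} \<in> sets M"
  using measurable_L1[of u] borel_measurable_less[of "\<lambda>_. s" M u] by simp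

definition dist1 :: "(real ^ 'n \<Rightarrow> real) \<Rightarrow> (real ^ 'n \<Rightarrow> real) \<Rightarrow> real" where
  "dist1 u v = (\<integral>x. \<bar>u x - v x\<bar> \<partial>M)"

lemma L1_converges_iff:
  "L1_converges \<Omega> un u \<longleftrightarrow> (\<forall>n. un n \<in> L1 \<Omega>) \<and> u \<in> L1 \<Omega> \<and> (\<lambda>n. dist1 (un n) u) \<longlonglongrightarrow> 0"
  using open_\<Omega>
  by (simp add: L1_converges_def dist1_def set_lebesgue_integral_def integral_restrict_space)

lemma dist1_nonneg: "0 \<le> dist1 u v"
  by (simp add: dist1_def)

lemma dist1_self [simp]: "dist1 u u = 0"
  by (simp add: dist1_def)

lemma dist1_commute: "dist1 u v = dist1 v u"
  by (simp add: dist1_def abs_minus_commute)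

lemma dist1_mono:
  assumes "integrable M f" "\<And>x. x \<in> \<Omega> \<Longrightarrow> \<bar>u x - v x\<bar> \<le> f x"
  shows "dist1 u v \<le> integral\<^sup>L M f"
  unfolding dist1_def
proof (rule integral_mono_AE')
  \<comment> \<open>Nonnegativity covers the case that the difference is not integrable, where
    \<open>dist1\<close> is 0 by the convention for the integral.\<close>
  show "AE x in M. 0 \<le> f x"
    by (rule AE_I2) (use assms(2) in \<open>force intro: order_trans[OF abs_ge_zero]\<close>)
qed (use assms in auto)

lemma dist1_triangle:
  assumes "u \<in> L1 \<Omega>" "v \<in> L1 \<Omega>" "w \<in> L1 \<Omega>"
  shows "dist1 u w \<le> dist1 u v + dist1 v w"
proof -
  have "dist1 u w \<le> (\<integral>x. \<bar>u x - v x\<bar> + \<bar>v x - w x\<bar> \<partial>M)"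
    using assms by (intro dist1_mono) (auto simp: L1_iff)
  also have "\<dots> = dist1 u v + dist1 v w"
    unfolding dist1_def using assms by (subst Bochner_Integration.integral_add) (auto simp: L1_iff)
  finally show ?thesis .
qed

lemma dist1_indicator_le:
  assumes "A \<in> sets M" "\<And>x. x \<in> \<Omega> \<Longrightarrow> x \<notin> A \<Longrightarrow> x \<in> E \<longleftrightarrow> x \<in> F"
  shows "dist1 (indicator E) (indicator F) \<le> measure M A"
proof -
  have "integrable M (indicator A :: _ \<Rightarrow> real)"
    using indicator_L1[OF assms(1)] by (simp add: L1_iff)
  then have "dist1 (indicator E) (indicator F) \<le> (\<integral>x. indicator A x \<partial>M)"
    by (rule dist1_mono) (use assms(2) in \<open>auto split: split_indicator\<close>)
  then show ?thesis using sets.Int_space_eq2[OF assms(1)] by simp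
qed

section \<open>Stability of superlevel sets\<close>

lemma dist1_Markov:
  assumes "u \<in> L1 \<Omega>" "v \<in> L1 \<Omega>" "c > 0"
  shows "measure M {x\<in>\<Omega>. \<bar>u x - v x\<bar> \<ge> c} \<le> dist1 u v / c"
  using integral_Markov_inequality_measure[of M "\<lambda>x. \<bar>u x - v x\<bar>" "{}" c] assms
  by (simp add: dist1_def L1_iff)

text \<open>The two superlevel sets can differ only where \<open>w\<close> is at least
  \<open>c\<close> away from \<open>u\<close> or \<open>u\<close> is within \<open>c\<close> of
  \<open>s\<close>. As \<open>c\<close> decreases to 0 the second set shrinks to
  \<open>{u = s}\<close>, which is null, so some \<open>c\<close> makes it small; for this fixed
  \<open>c\<close> Markov's inequality bounds the first.\<close>

lemma dist1_superlevel_small: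
  assumes "u \<in> L1 \<Omega>" and null: "measure M {x\<in>\<Omega>. u x = s} = 0" and "\<epsilon> > 0"
  shows "\<exists>\<eta>>0. \<forall>w\<in>L1 \<Omega>. dist1 w u < \<eta> \<longrightarrow>
    dist1 (indicator {x\<in>\<Omega>. w x > s}) (indicator {x\<in>\<Omega>. u x > s}) < \<epsilon>"
proof -
  have [measurable]: "u \<in> borel_measurable M" using assms(1) by (rule measurable_L1)
  define A where "A k = {x\<in>space M. \<bar>u x - s\<bar> \<le> 1 / real (Suc k)}" for k
  have meas: "A k \<in> sets M" for k unfolding A_def by measurable
  have "decseq A"
  proof (rule decseq_SucI)
    fix k
    have "1 / real (Suc (Suc k)) \<le> 1 / real (Suc k)" by (simp add: frac_le)
    then show "A (Suc k) \<subseteq> A k" unfolding A_def by force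
  qed
  then have "(\<lambda>k. measure M (A k)) \<longlonglongrightarrow> measure M (\<Inter>k. A k)"
    using meas by (intro finite_Lim_measure_decseq) auto
  moreover have "(\<Inter>k. A k) = {x\<in>\<Omega>. u x = s}"
  proof -
    have "u x = s" if "\<And>k. \<bar>u x - s\<bar> \<le> 1 / real (Suc k)" for x
    proof (rule ccontr)
      assume "u x \<noteq> s"
      then obtain k where "1 / real (Suc k) < \<bar>u x - s\<bar>" using nat_approx_posE[of "\<bar>u x - s\<bar>"] by auto
      with that[of k] show False by simp
    qed
    then show ?thesis unfolding A_def by auto
  qed
  ultimately have "(\<lambda>k. measure M (A k)) \<longlonglongrightarrow> 0" using null by simp
  then have "\<forall>\<^sub>F k in sequentially. measure M (A k) < \<epsilon> / 2"
    using assms(3) by (intro order_tendstoD(2)) auto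
  then obtain k where k: "measure M (A k) < \<epsilon> / 2" by (auto dest: eventually_happens)
  define c where "c = 1 / real (Suc k)"
  have c: "c > 0" by (simp add: c_def)
  have "dist1 (indicator {x\<in>\<Omega>. w x > s}) (indicator {x\<in>\<Omega>. u x > s}) < \<epsilon>"
    if w: "w \<in> L1 \<Omega>" and d: "dist1 w u < c * (\<epsilon> / 2)" for w
  proof -
    have [measurable]: "w \<in> borel_measurable M" using w by (rule measurable_L1)
    let ?B = "{x\<in>space M. \<bar>w x - u x\<bar> \<ge> c}"
    have B: "?B \<in> sets M" by measurable
    have "dist1 (indicator {x\<in>\<Omega>. w x > s}) (indicator {x\<in>\<Omega>. u x > s}) \<le> measure M (?B \<union> A k)"
      using B meas[of k] by (intro dist1_indicator_le) (auto simp: A_def c_def)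
    also have "\<dots> \<le> measure M ?B + measure M (A k)"
      using B meas by (intro measure_Un_le) auto
    also have "\<dots> \<le> dist1 w u / c + measure M (A k)"
      using dist1_Markov[OF w assms(1) c] by simp
    also have "\<dots> < \<epsilon> / 2 + \<epsilon> / 2"
      using d c k by (intro add_strict_mono) (simp_all add: field_simps)
    finally show ?thesis by simp
  qed
  moreover have "c * (\<epsilon> / 2) > 0" using c assms(3) by simp
  ultimately show ?thesis by blast
qed

text \<open>These are the atoms of the distribution of \<open>u\<close> under the finite measure
  \<open>M\<close>, hence countably many. At all other levels the preceding stability result
  applies.\<close>

definition jumps :: "(real ^ 'n \<Rightarrow> real) \<Rightarrow> real set" where
  "jumps u = {s. measure M {x\<in>\<Omega>. u x = s} \<noteq> 0}"

lemma countable_jumps: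
  assumes "u \<in> L1 \<Omega>"
  shows "countable (jumps u)"
proof -
  have u: "u \<in> borel_measurable M" using assms by (rule measurable_L1)
  interpret D: finite_measure "distr M borel u" using u by (rule finite_measure_distr)
  have "measure (distr M borel u) {s} = measure M {x\<in>\<Omega>. u x = s}" for s
    using u by (subst measure_distr) (auto simp: vimage_def Int_def conj_commute)
  then show ?thesis using D.countable_support by (simp add: jumps_def)
qed

lemma AE_not_jumps:
  assumes "u \<in> L1 \<Omega>"
  shows "AE s in lebesgue. s \<notin> jumps u"
proof -
  have "jumps u \<in> null_sets lborel"
    using countable_jumps[OF assms] by (rule countable_imp_null_set_lborel)
  then show ?thesis by (intro AE_completion) (rule AE_not_in)
qed

text \<open>A diagonal sequence over the tolerances \<open>1 / (k + 1)\<close>. The set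
  \<open>S\<close> keeps the sequence inside a class, either all of \<open>L1 \<Omega>\<close> or
  the indicators of Borel sets.\<close>

lemma recovery_from_approximations:
  assumes u: "u \<in> L1 \<Omega>" and S: "S \<subseteq> L1 \<Omega>"
    and approx: "\<And>e. e > 0 \<Longrightarrow> \<exists>x. (\<forall>n. x n \<in> S) \<and>
      (\<forall>\<^sub>F n in sequentially. dist1 (x n) u < e \<and> Jn n (x n) \<le> B + ennreal e)"
  shows "\<exists>x. (\<forall>n. x n \<in> S) \<and> L1_converges \<Omega> x u \<and> limsup (\<lambda>n. Jn n (x n)) \<le> B"
proof -
  define P where "P k n y \<longleftrightarrow> dist1 y u < 1 / real (Suc k) \<and> Jn n y \<le> B + ennreal (1 / real (Suc k))"
    for k n y
  have "\<exists>y. (\<forall>n. y n \<in> S) \<and> (\<forall>k. \<forall>\<^sub>F n in sequentially. P k n (y n))"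
  proof (rule eventually_diagonal)
    show "\<exists>x. (\<forall>n. x n \<in> S) \<and> (\<forall>\<^sub>F n in sequentially. P k n (x n))" for k
      using approx[of "1 / real (Suc k)"] by (simp add: P_def)
    fix j k n y assume "j \<le> (k::nat)" and P: "P k n y"
    then have le: "1 / real (Suc k) \<le> 1 / real (Suc j)" by (simp add: frac_le)
    then have "B + ennreal (1 / real (Suc k)) \<le> B + ennreal (1 / real (Suc j))"
      by (intro add_left_mono ennreal_leI)
    with P le show "P j n y" unfolding P_def by (meson order_trans less_le_trans)
  qed
  then obtain y where yS: "\<And>n. y n \<in> S" and ev: "\<And>k. \<forall>\<^sub>F n in sequentially. P k n (y n)" by blast
  have ev_e: "\<forall>\<^sub>F n in sequentially. dist1 (y n) u < e \<and> Jn n (y n) \<le> B + ennreal e"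
    if e: "e > 0" for e
  proof -
    obtain k where k: "1 / real (Suc k) < e" using nat_approx_posE[OF e] by auto
    then have "B + ennreal (1 / real (Suc k)) \<le> B + ennreal e"
      by (intro add_left_mono ennreal_leI) simp
    then show ?thesis
      by (intro eventually_mono[OF ev[of k]]) (use k in \<open>auto simp: P_def intro: order_trans\<close>)
  qed
  have "(\<lambda>n. dist1 (y n) u) \<longlonglongrightarrow> 0"
  proof (rule order_tendstoI)
    fix a :: real assume "0 < a"
    with ev_e[of a] show "\<forall>\<^sub>F n in sequentially. dist1 (y n) u < a" by (simp add: eventually_conj_iff)
  next
    fix a :: real assume "a < 0"
    then show "\<forall>\<^sub>F n in sequentially. a < dist1 (y n) u"
      by (intro always_eventually allI) (meson dist1_nonneg less_le_trans)
  qed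
  moreover have "limsup (\<lambda>n. Jn n (y n)) \<le> B"
    using ev_e by (intro limsup_le_of_eventually_plus) (simp add: eventually_conj_iff)
  ultimately show ?thesis using yS u S by (auto simp: L1_converges_iff)
qed

section \<open>Functionals satisfying the coarea formula\<close>

lemma GC_D:
  assumes "J \<in> GC \<Omega>" "u \<in> L1 \<Omega>" "J u \<noteq> \<infinity>"
  shows "(\<lambda>s. J (indicator {x\<in>\<Omega>. u x > s})) \<in> borel_measurable lebesgue"
    and "J u = (\<integral>\<^sup>+s. J (indicator {x\<in>\<Omega>. u x > s}) \<partial>lebesgue)"
proof -
  have eq: "J u = coarea_integral \<Omega> J u" using assms by (simp add: GC_def)
  then show meas: "(\<lambda>s. J (indicator {x\<in>\<Omega>. u x > s})) \<in> borel_measurable lebesgue"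
    using assms(3) unfolding coarea_integral_def by (auto split: if_splits)
  then show "J u = (\<integral>\<^sup>+s. J (indicator {x\<in>\<Omega>. u x > s}) \<partial>lebesgue)"
    using eq by (simp add: coarea_integral_def)
qed

lemma affine_L1: "u \<in> L1 \<Omega> \<Longrightarrow> (\<lambda>x. c + \<delta> * u x) \<in> L1 \<Omega>"
  by (simp add: L1_iff)

section \<open>Homogeneity and subadditivity\<close>

text \<open>Level \<open>s\<close> of \<open>c + \<delta> * u\<close> is level
  \<open>(s - c) / \<delta>\<close> of \<open>u\<close>, so the coarea integral scales by \<delta>
  under this substitution. If \<open>J u\<close> is infinite, so is the right-hand side.\<close>

lemma GC_affine_le:
  assumes J: "J \<in> GC \<Omega>" and u: "u \<in> L1 \<Omega>" and "\<delta> > 0"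
  shows "J (\<lambda>x. c + \<delta> * u x) \<le> ennreal \<delta> * J u"
proof (cases "J u = \<infinity>")
  case True
  with assms(3) show ?thesis by (simp add: ennreal_mult_top)
next
  case False
  define g where "g s = J (indicator {x\<in>\<Omega>. u x > s})" for s
  have g: "g \<in> borel_measurable lebesgue" "J u = (\<integral>\<^sup>+s. g s \<partial>lebesgue)"
    using GC_D[OF J u False] by (simp_all add: g_def[abs_def])
  define f where "f s = g ((s - c) / \<delta>)" for s
  have fJ: "J (indicator {x\<in>\<Omega>. c + \<delta> * u x > s}) = f s" for s
  proof -
    have "{x\<in>\<Omega>. c + \<delta> * u x > s} = {x\<in>\<Omega>. u x > (s - c) / \<delta>}"
      using assms(3) by (auto simp: field_simps)
    then show ?thesis by (simp add: f_def g_def)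
  qed
  \<comment> \<open>Measurability is with respect to Lebesgue sets on both sides, so Borel
    measurability of the affine map would not be enough for the composition; its slope has to be
    nonzero.\<close>
  have "(\<lambda>s. - c / \<delta> + (1 / \<delta>) * s) \<in> lebesgue \<rightarrow>\<^sub>M lebesgue"
    using lebesgue_affine_measurable[of "\<lambda>_. 1 / \<delta>" "- c / \<delta>"] assms(3) by simp
  from measurable_compose[OF this g(1)] have f: "f \<in> borel_measurable lebesgue"
    using assms(3) by (simp add: f_def[abs_def] diff_divide_distrib algebra_simps)
  have "J (\<lambda>x. c + \<delta> * u x) = coarea_integral \<Omega> J (\<lambda>x. c + \<delta> * u x)"
    using J affine_L1[OF u] by (simp add: GC_def)
  also have "\<dots> = (\<integral>\<^sup>+s. f s \<partial>lebesgue)"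
    using f by (simp add: coarea_integral_def fJ)
  also have "\<dots> = ennreal \<bar>\<delta>\<bar> * (\<integral>\<^sup>+s. f (c + \<delta> * s) \<partial>lebesgue)"
    using f assms(3) by (intro nn_integral_real_affine_lebesgue) auto
  also have "\<dots> = ennreal \<delta> * J u"
    using assms(3) by (simp add: f_def g(2))
  finally show ?thesis by simp
qed

text \<open>Convexity at the midpoint of \<open>2 * u\<close> and \<open>2 * v\<close>, whose
  energies are at most twice those of \<open>u\<close> and \<open>v\<close>.\<close>

lemma GC_add_le:
  assumes J: "J \<in> GC \<Omega>" "convex_functional \<Omega> J" and u: "u \<in> L1 \<Omega>" and v: "v \<in> L1 \<Omega>"
  shows "J (\<lambda>x. u x + v x) \<le> J u + J v"
proof -
  have half: "ennreal (1/2) * J (\<lambda>x. 2 * w x) \<le> J w" if "w \<in> L1 \<Omega>" for w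
  proof -
    have "ennreal (1/2) * J (\<lambda>x. 2 * w x) \<le> ennreal (1/2) * (ennreal 2 * J w)"
      using GC_affine_le[OF J(1) that, of 2 0] by (intro mult_left_mono) auto
    also have "\<dots> = J w"
      by (simp only: mult.assoc[symmetric] ennreal_mult[symmetric]) simp
    finally show ?thesis .
  qed
  have "J (\<lambda>x. u x + v x) = J (\<lambda>x. (1/2) * (2 * u x) + (1 - 1/2) * (2 * v x))" by simp
  also have "\<dots> \<le> ennreal (1/2) * J (\<lambda>x. 2 * u x) + ennreal (1 - 1/2) * J (\<lambda>x. 2 * v x)"
  proof -
    have "(\<lambda>x. 2 * u x) \<in> L1 \<Omega>" "(\<lambda>x. 2 * v x) \<in> L1 \<Omega>" using u v by (simp_all add: L1_iff)
    with J(2)[unfolded convex_functional_def, THEN bspec, THEN bspec, THEN bspec,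
        of "\<lambda>x. 2 * u x" "\<lambda>x. 2 * v x" "1/2"]
    show ?thesis by simp
  qed
  also have "\<dots> \<le> J u + J v" using half[OF u] half[OF v] by (intro add_mono) simp_all
  finally show ?thesis .
qed

text \<open>The constant \<open>a\<close> is absorbed by the first summand through the affine bound,
  so the induction starts at one term.\<close>

lemma GC_sum_le:
  fixes K :: nat
  assumes J: "J \<in> GC \<Omega>" "convex_functional \<Omega> J" and f: "\<And>i. i < K \<Longrightarrow> f i \<in> L1 \<Omega>"
    and "K > 0" "\<delta> > 0"
  shows "J (\<lambda>x. a + (\<Sum>i<K. \<delta> * f i x)) \<le> (\<Sum>i<K. ennreal \<delta> * J (f i))"
  using \<open>K > 0\<close> f
proof (induction K rule: nat_induct_non_zero)
  case 1
  then show ?case using GC_affine_le[OF J(1) _ \<open>\<delta> > 0\<close>, of "f 0" a] by simp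
next
  case (Suc K)
  have "J (\<lambda>x. (a + (\<Sum>i<K. \<delta> * f i x)) + (0 + \<delta> * f K x))
      \<le> J (\<lambda>x. a + (\<Sum>i<K. \<delta> * f i x)) + J (\<lambda>x. 0 + \<delta> * f K x)"
    using Suc.prems by (intro GC_add_le[OF J])
      (auto simp: L1_iff intro!: Bochner_Integration.integrable_add Bochner_Integration.integrable_sum)
  also have "\<dots> \<le> (\<Sum>i<K. ennreal \<delta> * J (f i)) + ennreal \<delta> * J (f K)"
    using Suc.IH Suc.prems by (intro add_mono GC_affine_le[OF J(1) _ \<open>\<delta> > 0\<close>]) auto
  finally show ?case by (simp add: add.assoc)
qed

text \<open>Superlevel sets of a function of finite energy at very high (very low) levels are close to the
  empty set (to \<open>\<Omega>\<close>) and, by integrability over levels, some of them have small energy.\<close>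

lemma GC_small_superlevel:
  assumes J: "J \<in> GC \<Omega>" and "e > 0"
  shows "\<exists>E\<in>sets M. dist1 (indicator E) (indicator {}) < e \<and> J (indicator E) \<le> ennreal e"
    and "\<exists>E\<in>sets M. dist1 (indicator E) (indicator \<Omega>) < e \<and> J (indicator E) \<le> ennreal e"
proof -
  obtain u where u: "u \<in> L1 \<Omega>" "J u \<noteq> \<infinity>"
    using J by (auto simp: GC_def proper_functional_def)
  define g where "g s = J (indicator {x\<in>\<Omega>. u x > s})" for s
  have g: "J u = (\<integral>\<^sup>+s. g s \<partial>lebesgue)"
    using GC_D[OF J u] by (simp add: g_def[abs_def])
  have [measurable]: "u \<in> borel_measurable M" using u(1) by (rule measurable_L1)
  have z: "(\<lambda>_. 0) \<in> L1 \<Omega>" by (simp add: L1_iff)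
  \<comment> \<open>With this \<open>R\<close>, Markov's inequality gives the set where the modulus
    of \<open>u\<close> is at least \<open>R\<close> measure below \<open>e\<close>; the summand 1
    makes the bound strict and \<open>R\<close> positive.\<close>
  define R where "R = dist1 u (\<lambda>_. 0) / e + 1"
  have R: "R > 0" "dist1 u (\<lambda>_. 0) < e * R"
    using dist1_nonneg[of u "\<lambda>_. 0"] \<open>e > 0\<close> by (auto simp: R_def field_simps add_nonneg_pos)
  let ?B = "{x\<in>space M. \<bar>u x - 0\<bar> \<ge> R}"
  have B: "?B \<in> sets M" by measurable
  have "measure M ?B \<le> dist1 u (\<lambda>_. 0) / R" using dist1_Markov[OF u(1) z R(1)] by simp
  also have "\<dots> < e" using R by (simp add: field_simps)
  finally have Be: "measure M ?B < e" .
  have level: "\<exists>s\<in>S. g s < ennreal e" if "S \<in> sets borel" "emeasure lborel S = \<infinity>" for S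
  proof (rule exists_less_if_nn_integral_less)
    show "S \<in> sets lebesgue" using that by auto
    have "(\<integral>\<^sup>+s\<in>S. g s \<partial>lebesgue) \<le> J u"
      unfolding g by (intro nn_integral_mono) (auto split: split_indicator)
    also have "\<dots> < ennreal e * emeasure lebesgue S"
      using that u(2) \<open>e > 0\<close> by (simp add: ennreal_mult_top less_top)
    finally show "(\<integral>\<^sup>+s\<in>S. g s \<partial>lebesgue) < ennreal e * emeasure lebesgue S" .
  qed
  from level[OF _ emeasure_lborel_halfline(1)[of R]] obtain s where s: "s \<ge> R" "g s < ennreal e" by auto
  have "dist1 (indicator {x\<in>\<Omega>. u x > s}) (indicator {}) \<le> measure M ?B"
    using s by (intro dist1_indicator_le[OF B]) auto
  with s Be superlevel_sets[OF u(1), of s]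
  show "\<exists>E\<in>sets M. dist1 (indicator E) (indicator {}) < e \<and> J (indicator E) \<le> ennreal e"
    unfolding g_def by (intro bexI[of _ "{x\<in>\<Omega>. u x > s}"]) auto
  from level[OF _ emeasure_lborel_halfline(2)[of "- R"]] obtain s where s: "s \<le> - R" "g s < ennreal e" by auto
  have "dist1 (indicator {x\<in>\<Omega>. u x > s}) (indicator \<Omega>) \<le> measure M ?B"
    using s by (intro dist1_indicator_le[OF B]) auto
  with s Be superlevel_sets[OF u(1), of s]
  show "\<exists>E\<in>sets M. dist1 (indicator E) (indicator \<Omega>) < e \<and> J (indicator E) \<le> ennreal e"
    unfolding g_def by (intro bexI[of _ "{x\<in>\<Omega>. u x > s}"]) auto
qed

section \<open>From recovery functions to recovery sets\<close>

text \<open>By the coarea formula \<open>Jn n (un n)\<close> bounds the integral of the energies of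
  the superlevel sets over levels between \<delta> and 1 - \<delta>, so some level in this range has
  energy below \<open>b + e\<close>. Such a superlevel set differs from \<open>E\<close> only where
  \<open>un n\<close> is at least \<delta> away from the indicator of \<open>E\<close>, a small set
  by Markov's inequality.\<close>

lemma GC_recovery_on_sets:
  assumes J: "\<And>n. Jn n \<in> GC \<Omega>" and E: "E \<in> sets M"
    and un: "L1_converges \<Omega> un (indicator E)" "limsup (\<lambda>n. Jn n (un n)) \<le> B"
  shows "\<exists>En. (\<forall>n. En n \<in> sets M) \<and> L1_converges \<Omega> (\<lambda>n. indicator (En n)) (indicator E) \<and>
    limsup (\<lambda>n. Jn n (indicator (En n))) \<le> B"
proof -
  let ?S = "indicator ` sets M :: (real ^ 'n \<Rightarrow> real) set"
  have unL: "\<And>n. un n \<in> L1 \<Omega>" and conv: "(\<lambda>n. dist1 (un n) (indicator E)) \<longlonglongrightarrow> 0"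
    using un(1) by (auto simp: L1_converges_iff)
  have "\<exists>x. (\<forall>n. x n \<in> ?S) \<and> L1_converges \<Omega> x (indicator E) \<and> limsup (\<lambda>n. Jn n (x n)) \<le> B"
  proof (rule recovery_from_approximations)
    fix e :: real assume "e > 0"
    show "\<exists>x. (\<forall>n. x n \<in> ?S) \<and> (\<forall>\<^sub>F n in sequentially.
      dist1 (x n) (indicator E) < e \<and> Jn n (x n) \<le> B + ennreal e)"
    proof (cases "B = \<infinity>")
      case True
      with E \<open>e > 0\<close> show ?thesis by (intro exI[of _ "\<lambda>_. indicator E"]) auto
    next
      case False
      then obtain b where b: "B = ennreal b" "b \<ge> 0" by (cases B) auto
      \<comment> \<open>Chosen so that the energy bound \<open>b + \<delta>\<close> stays below
        \<open>b + e\<close> times the length 1 - 2 \<delta> of the range of levels. The final 2 in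
        the denominator provides the strict margin; the bound 1/4 keeps the length positive.\<close>
      define \<delta> where "\<delta> = min (1/4) (e / (2 * b + 2 * e + 2))"
      have D: "2 * b + 2 * e + 2 > 0" using b \<open>e > 0\<close> by simp
      have "\<delta> \<le> e / (2 * b + 2 * e + 2)" by (simp add: \<delta>_def)
      then have "\<delta> * (2 * b + 2 * e + 2) \<le> e" using D by (simp only: pos_le_divide_eq)
      moreover have "\<delta> > 0" using D \<open>e > 0\<close> by (simp add: \<delta>_def)
      moreover have "\<delta> \<le> 1/4" unfolding \<delta>_def by (rule min.cobounded1)
      ultimately have \<delta>: "\<delta> > 0" "\<delta> \<le> 1/4" "\<delta> * (2 * b + 2 * e + 2) \<le> e" by blast+
      have key: "b + \<delta> < (b + e) * (1 - 2 * \<delta>)"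
      proof -
        have "(b + e) * (1 - 2 * \<delta>) = b + e - \<delta> * (2 * b + 2 * e + 2) + 2 * \<delta>"
          by (simp add: algebra_simps)
        with \<delta> show ?thesis by linarith
      qed
      \<comment> \<open>Markov's inequality at height \<delta> divides this bound by \<delta> and
        leaves \<open>e\<close>.\<close>
      have "\<forall>\<^sub>F n in sequentially. dist1 (un n) (indicator E) < \<delta> * e"
        using \<delta> \<open>e > 0\<close> by (intro order_tendstoD(2)[OF conv]) simp
      moreover have "\<forall>\<^sub>F n in sequentially. Jn n (un n) \<le> B + ennreal \<delta>"
        using eventually_le_limsup_plus[OF un(2) \<delta>(1)] .
      ultimately have "\<forall>\<^sub>F n in sequentially. \<exists>F\<in>sets M. dist1 (indicator F) (indicator E) < e \<and>
        Jn n (indicator F) \<le> B + ennreal e"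
      proof eventually_elim
        case (elim n)
        define g where "g s = Jn n (indicator {x\<in>\<Omega>. un n x > s})" for s
        have fin: "Jn n (un n) \<noteq> \<infinity>" using elim(2) b by (auto simp: top_unique)
        have "(\<integral>\<^sup>+s\<in>{\<delta>..1-\<delta>}. g s \<partial>lebesgue) \<le> Jn n (un n)"
          unfolding GC_D(2)[OF J unL fin] g_def[symmetric]
          by (intro nn_integral_mono) (auto split: split_indicator)
        also have "\<dots> \<le> ennreal (b + \<delta>)" using elim(2) b \<delta>(1) by simp
        also have "\<dots> < ennreal ((b + e) * (1 - 2 * \<delta>))"
          using key b \<delta> by (intro ennreal_lessI) auto
        also have "\<dots> = ennreal (b + e) * emeasure lebesgue {\<delta>..1-\<delta>}"
          using b \<open>e > 0\<close> \<delta> by (subst ennreal_mult) auto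
        finally obtain s where s: "\<delta> \<le> s" "s \<le> 1 - \<delta>" "g s < ennreal (b + e)"
          using exists_less_if_nn_integral_less[of "{\<delta>..1-\<delta>}" lebesgue g "ennreal (b + e)"] by auto
        have [measurable]: "un n \<in> borel_measurable M" using unL by (rule measurable_L1)
        have [measurable]: "E \<in> sets M" by (rule E)
        have C: "{x\<in>space M. \<bar>un n x - indicator E x\<bar> \<ge> \<delta>} \<in> sets M" by measurable
        have "dist1 (indicator {x\<in>\<Omega>. un n x > s}) (indicator E)
            \<le> measure M {x\<in>space M. \<bar>un n x - indicator E x\<bar> \<ge> \<delta>}"
          using s by (intro dist1_indicator_le[OF C]) (auto split: split_indicator_asm)
        also have "\<dots> \<le> dist1 (un n) (indicator E) / \<delta>"
          using dist1_Markov[OF unL indicator_L1[OF E] \<delta>(1)] by simp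
        also have "\<dots> < e" using elim(1) \<delta>(1) by (simp add: field_simps)
        finally show ?case
          using superlevel_sets[OF unL[of n], of s] s(3) b \<open>e > 0\<close>
          by (intro bexI[of _ "{x\<in>\<Omega>. un n x > s}"]) (auto simp: g_def)
      qed
      then have "\<forall>\<^sub>F n in sequentially. \<exists>y\<in>?S. dist1 y (indicator E) < e \<and> Jn n y \<le> B + ennreal e"
        by eventually_elim blast
      then obtain N where N: "\<forall>n\<ge>N. \<exists>y\<in>?S. dist1 y (indicator E) < e \<and> Jn n y \<le> B + ennreal e"
        unfolding eventually_sequentially by blast
      \<comment> \<open>The finitely many indices before \<open>N\<close> are filled with
        \<open>E\<close> itself.\<close>
      have "\<forall>n. \<exists>y. y \<in> ?S \<and> (n \<ge> N \<longrightarrow> dist1 y (indicator E) < e \<and> Jn n y \<le> B + ennreal e)"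
        using N E by (metis image_eqI)
      then obtain x where "\<forall>n. x n \<in> ?S \<and> (n \<ge> N \<longrightarrow> dist1 (x n) (indicator E) < e \<and> Jn n (x n) \<le> B + ennreal e)"
        by metis
      then show ?thesis unfolding eventually_sequentially by blast
    qed
  qed (use E indicator_L1 in auto)
  then obtain x where x: "\<forall>n. x n \<in> ?S" "L1_converges \<Omega> x (indicator E)" "limsup (\<lambda>n. Jn n (x n)) \<le> B"
    by blast
  then have "\<forall>n. \<exists>F\<in>sets M. x n = indicator F" by blast
  then obtain En where "\<And>n. En n \<in> sets M" "\<And>n. x n = indicator (En n)" by metis
  then have "x = (\<lambda>n. indicator (En n))" by auto
  with x \<open>\<And>n. En n \<in> sets M\<close> show ?thesis by auto
qed

end

section \<open>The limit functional on sets\<close>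

locale set_limit = bounded_open_set \<Omega> for \<Omega> :: "(real ^ 'n) set" +
  fixes Jn :: "nat \<Rightarrow> (real ^ 'n \<Rightarrow> real) \<Rightarrow> ennreal" and Jt :: "(real ^ 'n \<Rightarrow> real) \<Rightarrow> ennreal"
  assumes Jn_GC: "\<And>n. Jn n \<in> GC \<Omega>"
    and liminf_sets: "liminf_on_sets \<Omega> Jn Jt" and recovery_sets: "recovery_on_sets \<Omega> Jn Jt"
begin

lemma liminf_setsD:
  assumes "E \<in> sets M" "\<And>n. En n \<in> sets M"
    and "(\<lambda>n. dist1 (indicator (En n)) (indicator E)) \<longlonglongrightarrow> 0"
  shows "Jt (indicator E) \<le> liminf (\<lambda>n. Jn n (indicator (En n)))"
proof -
  have "L1_converges \<Omega> (\<lambda>n. indicator (En n)) (indicator E)"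
    using assms indicator_L1 by (auto simp: L1_converges_iff)
  with assms liminf_sets show ?thesis unfolding liminf_on_sets_def sets_M by blast
qed

lemma recovery_setsD:
  assumes "E \<in> sets M"
  obtains En where "\<And>n. En n \<in> sets M"
    "(\<lambda>n. dist1 (indicator (En n)) (indicator E)) \<longlonglongrightarrow> 0"
    "limsup (\<lambda>n. Jn n (indicator (En n))) \<le> Jt (indicator E)"
proof -
  from recovery_sets assms obtain En where En: "\<forall>n. En n \<in> sets borel \<and> En n \<subseteq> \<Omega>"
      "L1_converges \<Omega> (\<lambda>n. indicator (En n)) (indicator E)"
      "limsup (\<lambda>n. Jn n (indicator (En n))) \<le> Jt (indicator E)"
    unfolding recovery_on_sets_def sets_M by blast
  show thesis by (rule that[of En]) (use En in \<open>auto simp: sets_M L1_converges_iff\<close>)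
qed

section \<open>Lower semicontinuity on sets\<close>

text \<open>The approximations are merged into one sequence of sets converging to \<open>E\<close>
  with upper limit of energies at most \<open>B\<close>; condition (a) then bounds the value at
  \<open>E\<close>.\<close>

lemma Jt_le_of_approximations:
  assumes E: "E \<in> sets M"
    and approx: "\<And>e. e > 0 \<Longrightarrow> \<exists>En. (\<forall>n. En n \<in> sets M) \<and> (\<forall>\<^sub>F n in sequentially.
      dist1 (indicator (En n)) (indicator E) < e \<and> Jn n (indicator (En n)) \<le> B + ennreal e)"
  shows "Jt (indicator E) \<le> B"
proof -
  let ?S = "indicator ` sets M :: (real ^ 'n \<Rightarrow> real) set"
  have "\<exists>x. (\<forall>n. x n \<in> ?S) \<and> L1_converges \<Omega> x (indicator E) \<and> limsup (\<lambda>n. Jn n (x n)) \<le> B"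
  proof (rule recovery_from_approximations)
    fix e :: real assume "e > 0"
    from approx[OF this] obtain En where "\<forall>n. En n \<in> sets M" "\<forall>\<^sub>F n in sequentially.
      dist1 (indicator (En n)) (indicator E) < e \<and> Jn n (indicator (En n)) \<le> B + ennreal e"
      by blast
    then show "\<exists>x. (\<forall>n. x n \<in> ?S) \<and> (\<forall>\<^sub>F n in sequentially.
      dist1 (x n) (indicator E) < e \<and> Jn n (x n) \<le> B + ennreal e)"
      by (intro exI[of _ "\<lambda>n. indicator (En n)"]) auto
  qed (use E indicator_L1 in auto)
  then obtain x where x: "\<forall>n. x n \<in> ?S" "L1_converges \<Omega> x (indicator E)" "limsup (\<lambda>n. Jn n (x n)) \<le> B"
    by blast
  then have "\<forall>n. \<exists>F\<in>sets M. x n = indicator F" by blast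
  then obtain En where En: "\<And>n. En n \<in> sets M" "\<And>n. x n = indicator (En n)" by metis
  have "Jt (indicator E) \<le> liminf (\<lambda>n. Jn n (x n))"
    using x(2) unfolding En(2) L1_converges_iff by (intro liminf_setsD E En(1)) blast
  also have "\<dots> \<le> limsup (\<lambda>n. Jn n (x n))" by (simp add: Liminf_le_Limsup)
  finally show ?thesis using x(3) by simp
qed

text \<open>A set \<open>F\<close> near \<open>E\<close> is replaced by its recovery sequence from
  (b), which eventually is just as near to \<open>E\<close> and has energy at most
  \<open>B + e\<close>. In other words, sublevel sets of \<open>Jt\<close> are closed.\<close>

lemma Jt_lower_semicontinuous:
  assumes E: "E \<in> sets M"
    and close: "\<And>e. e > 0 \<Longrightarrow> \<exists>F\<in>sets M. dist1 (indicator F) (indicator E) < e \<and> Jt (indicator F) \<le> B"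
  shows "Jt (indicator E) \<le> B"
proof (rule Jt_le_of_approximations[OF E])
  fix e :: real assume "e > 0"
  then obtain F where F: "F \<in> sets M" "dist1 (indicator F) (indicator E) < e / 2" "Jt (indicator F) \<le> B"
    using close[of "e / 2"] by auto
  obtain En where En: "\<And>n. En n \<in> sets M"
    "(\<lambda>n. dist1 (indicator (En n)) (indicator F)) \<longlonglongrightarrow> 0"
    "limsup (\<lambda>n. Jn n (indicator (En n))) \<le> Jt (indicator F)"
    using recovery_setsD[OF F(1)] by blast
  have "limsup (\<lambda>n. Jn n (indicator (En n))) \<le> B" using En(3) F(3) by simp
  from eventually_le_limsup_plus[OF this \<open>e > 0\<close>]
  have "\<forall>\<^sub>F n in sequentially. Jn n (indicator (En n)) \<le> B + ennreal e" .
  moreover have "\<forall>\<^sub>F n in sequentially. dist1 (indicator (En n)) (indicator F) < e / 2"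
    using \<open>e > 0\<close> by (intro order_tendstoD(2)[OF En(2)]) simp
  ultimately have "\<forall>\<^sub>F n in sequentially.
    dist1 (indicator (En n)) (indicator E) < e \<and> Jn n (indicator (En n)) \<le> B + ennreal e"
  proof eventually_elim
    case (elim n)
    have "dist1 (indicator (En n)) (indicator E)
        \<le> dist1 (indicator (En n)) (indicator F) + dist1 (indicator F) (indicator E)"
      by (intro dist1_triangle indicator_L1 En(1) F(1) E)
    with elim F(2) show ?case by simp
  qed
  with En(1) show "\<exists>En. (\<forall>n. En n \<in> sets M) \<and> (\<forall>\<^sub>F n in sequentially.
      dist1 (indicator (En n)) (indicator E) < e \<and> Jn n (indicator (En n)) \<le> B + ennreal e)" by blast
qed

text \<open>Each set is an arbitrarily good approximation of the other, so semicontinuity applies in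
  both directions. Hence \<open>Jt\<close> respects equality almost everywhere, which was not part
  of the assumptions on it.\<close>

lemma Jt_cong_dist1:
  assumes "E \<in> sets M" "F \<in> sets M" "dist1 (indicator E) (indicator F) = 0"
  shows "Jt (indicator E) = Jt (indicator F)"
proof (rule antisym)
  show "Jt (indicator E) \<le> Jt (indicator F)"
  proof (rule Jt_lower_semicontinuous[OF assms(1)])
    fix e :: real assume "e > 0"
    with assms show "\<exists>F'\<in>sets M. dist1 (indicator F') (indicator E) < e \<and> Jt (indicator F') \<le> Jt (indicator F)"
      by (intro bexI[of _ F]) (auto simp: dist1_commute[of "indicator F"])
  qed
  show "Jt (indicator F) \<le> Jt (indicator E)"
    by (rule Jt_lower_semicontinuous[OF assms(2)]) (use assms in force)
qed

text \<open>Each \<open>Jn n\<close> has sets of arbitrarily small energy arbitrarily near to the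
  empty set and to \<Omega>. This removes the levels outside [0, 1) from the coarea integral of an
  indicator.\<close>

lemma Jt_empty: "Jt (indicator {}) = 0" and Jt_full: "Jt (indicator \<Omega>) = 0"
proof -
  have *: "Jt (indicator E) \<le> 0" if E: "E \<in> sets M"
    and small: "\<And>n e. e > 0 \<Longrightarrow> \<exists>F\<in>sets M. dist1 (indicator F) (indicator E) < e \<and> Jn n (indicator F) \<le> ennreal e"
    for E
  proof (rule Jt_le_of_approximations[OF E])
    fix e :: real assume "e > 0"
    then obtain En where "\<And>n. En n \<in> sets M \<and> dist1 (indicator (En n)) (indicator E) < e \<and>
        Jn n (indicator (En n)) \<le> ennreal e"
      using small[of e] by metis
    then show "\<exists>En. (\<forall>n. En n \<in> sets M) \<and> (\<forall>\<^sub>F n in sequentially.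
      dist1 (indicator (En n)) (indicator E) < e \<and> Jn n (indicator (En n)) \<le> 0 + ennreal e)"
      by (intro exI[of _ En]) auto
  qed
  show "Jt (indicator {}) = 0"
    using *[of "{}"] GC_small_superlevel(1)[OF Jn_GC] by simp
  show "Jt (indicator \<Omega>) = 0"
    using *[of \<Omega>] GC_small_superlevel(2)[OF Jn_GC] sets.top[of M] by simp
qed

section \<open>The coarea formula for the limit\<close>

text \<open>At a level outside \<open>jumps u\<close> nearby superlevel sets are close in
  \<open>L1\<close>, so semicontinuity of \<open>Jt\<close> preserves a strict lower bound in a
  neighbourhood. Strict superlevel sets of the function of \<open>s\<close> are therefore open up to
  a countable set.\<close>

lemma measurable_level:
  assumes u: "u \<in> L1 \<Omega>"
  shows "(\<lambda>s. Jt (indicator {x\<in>\<Omega>. u x > s})) \<in> borel_measurable lebesgue"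
proof -
  let ?E = "\<lambda>s. {x\<in>\<Omega>. u x > s}"
  have "(\<lambda>s. Jt (indicator (?E s))) \<in> borel_measurable borel"
  proof (rule borel_measurableI_greater)
    fix B
    have "{s. B < Jt (indicator (?E s))} \<in> sets borel"
    proof (rule open_Un_countable_borel[OF countable_jumps[OF u]])
      fix s assume "s \<in> {s. B < Jt (indicator (?E s))}" and s: "s \<notin> jumps u"
      then have B: "B < Jt (indicator (?E s))" by simp
      have "\<exists>r>0. \<forall>t. \<bar>t - s\<bar> < r \<longrightarrow> B < Jt (indicator (?E t))"
      proof (rule ccontr)
        assume no: "\<not> ?thesis"
        have "Jt (indicator (?E s)) \<le> B"
        proof (rule Jt_lower_semicontinuous[OF superlevel_sets[OF u]])
          fix e :: real assume "e > 0"
          from dist1_superlevel_small[OF u _ this, of s] s obtain \<eta> where \<eta>: "\<eta> > 0"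
            "\<And>w. w \<in> L1 \<Omega> \<Longrightarrow> dist1 w u < \<eta> \<Longrightarrow> dist1 (indicator {x\<in>\<Omega>. w x > s}) (indicator (?E s)) < e"
            by (auto simp: jumps_def)
          \<comment> \<open>A shift of \<open>u\<close> by less than \<open>r\<close> moves it by
            less than \<eta> in \<open>L1\<close>; the summand 1 keeps the denominator positive when
            \<Omega> is null.\<close>
          define r where "r = \<eta> / (measure M \<Omega> + 1)"
          have pos: "measure M \<Omega> + 1 > 0" by (simp add: add_nonneg_pos)
          then have r: "r > 0" using \<eta>(1) by (simp add: r_def)
          with no have "\<exists>t. \<bar>t - s\<bar> < r \<and> Jt (indicator (?E t)) \<le> B" by (metis not_less)
          then obtain t where t: "\<bar>t - s\<bar> < r" "Jt (indicator (?E t)) \<le> B" by blast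
          \<comment> \<open>Changing the level is traded for translating the function: level
            \<open>t\<close> of \<open>u\<close> is level \<open>s\<close> of \<open>w\<close>, so
            stability at the single level \<open>s\<close> suffices.\<close>
          define w where "w x = (s - t) + 1 * u x" for x
          have w: "w \<in> L1 \<Omega>" unfolding w_def[abs_def] by (rule affine_L1[OF u])
          have "dist1 w u = \<bar>s - t\<bar> * measure M \<Omega>" by (simp add: dist1_def w_def)
          also have "\<dots> \<le> r * measure M \<Omega>" using t by (intro mult_right_mono) auto
          also have "\<dots> < r * (measure M \<Omega> + 1)" using r by simp
          also have "\<dots> = \<eta>" using pos by (simp add: r_def)
          finally have "dist1 (indicator {x\<in>\<Omega>. w x > s}) (indicator (?E s)) < e"
            by (intro \<eta>(2) w)
          moreover have "{x\<in>\<Omega>. w x > s} = ?E t" by (auto simp: w_def)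
          ultimately show "\<exists>F\<in>sets M. dist1 (indicator F) (indicator (?E s)) < e \<and> Jt (indicator F) \<le> B"
            using t(2) superlevel_sets[OF u] by auto
        qed
        with B show False by simp
      qed
      then obtain r where "r > 0" "\<And>t. \<bar>t - s\<bar> < r \<Longrightarrow> B < Jt (indicator (?E t))" by blast
      then show "\<exists>U. open U \<and> s \<in> U \<and> U \<subseteq> {s. B < Jt (indicator (?E s))}"
        by (intro exI[of _ "ball s r"]) (auto simp: dist_real_def abs_minus_commute)
    qed
    then show "{s \<in> space borel. B < Jt (indicator (?E s))} \<in> sets borel" by simp
  qed
  then show ?thesis by (intro measurable_completion) simp
qed

lemma coarea_eq:
  "u \<in> L1 \<Omega> \<Longrightarrow> coarea_integral \<Omega> Jt u = (\<integral>\<^sup>+s. Jt (indicator {x\<in>\<Omega>. u x > s}) \<partial>lebesgue)"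
  by (simp add: coarea_integral_def measurable_level)

lemma coarea_indicator:
  assumes E: "E \<in> sets M"
  shows "coarea_integral \<Omega> Jt (indicator E) = Jt (indicator E)"
proof -
  have "E \<subseteq> \<Omega>" using E by (simp add: sets_M)
  have level: "Jt (indicator {x\<in>\<Omega>. indicat_real E x > s}) = Jt (indicator E) * indicator {0..<1} s" for s
  proof -
    have "{x\<in>\<Omega>. indicat_real E x > s} = (if s < 0 then \<Omega> else if s < 1 then E else {})"
      using \<open>E \<subseteq> \<Omega>\<close> by (auto split: split_indicator_asm split_indicator)
    then show ?thesis by (simp add: Jt_empty Jt_full)
  qed
  show ?thesis
    unfolding coarea_eq[OF indicator_L1[OF E]] level by (subst nn_integral_cmult_indicator) auto
qed

text \<open>Since \<open>coarea_integral \<Omega> Jt\<close> agrees with \<open>Jt\<close> on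
  indicators, its coarea formula is its own definition. Properness is witnessed by the empty
  set.\<close>

lemma coarea_GC: "coarea_integral \<Omega> Jt \<in> GC \<Omega>"
  unfolding GC_def
proof (intro CollectI conjI ballI)
  show "L1_functional \<Omega> (coarea_integral \<Omega> Jt)"
    unfolding L1_functional_def
  proof (intro ballI impI)
    fix u v assume u: "u \<in> L1 \<Omega>" and v: "v \<in> L1 \<Omega>" and "AE x\<in>\<Omega> in lborel. u x = v x"
    then have eq: "AE x in M. u x = v x"
      using open_\<Omega> by (subst AE_restrict_space_iff) auto
    have "Jt (indicator {x\<in>\<Omega>. u x > s}) = Jt (indicator {x\<in>\<Omega>. v x > s})" for s
    proof (rule Jt_cong_dist1[OF superlevel_sets[OF u] superlevel_sets[OF v]])
      have "AE x in M. \<bar>indicat_real {x\<in>\<Omega>. u x > s} x - indicat_real {x\<in>\<Omega>. v x > s} x\<bar> = 0"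
        using eq by eventually_elim (auto simp: indicator_def)
      then show "dist1 (indicator {x\<in>\<Omega>. u x > s}) (indicator {x\<in>\<Omega>. v x > s}) = 0"
        unfolding dist1_def by (rule integral_eq_zero_AE)
    qed
    then show "coarea_integral \<Omega> Jt u = coarea_integral \<Omega> Jt v"
      by (simp add: coarea_integral_def)
  qed
  have "coarea_integral \<Omega> Jt (indicator {}) = 0"
    using coarea_indicator[of "{}"] by (simp add: Jt_empty)
  then show "proper_functional \<Omega> (coarea_integral \<Omega> Jt)"
    unfolding proper_functional_def using indicator_L1[of "{}"] by force
  fix u assume "u \<in> L1 \<Omega>"
  then have "coarea_integral \<Omega> Jt (indicator {x\<in>\<Omega>. u x > s}) = Jt (indicator {x\<in>\<Omega>. u x > s})" for s
    by (intro coarea_indicator superlevel_sets)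
  then show "coarea_integral \<Omega> Jt u = coarea_integral \<Omega> (coarea_integral \<Omega> Jt) u"
    unfolding coarea_integral_def[of \<Omega> _ u] by simp
qed

section \<open>The liminf inequality\<close>

text \<open>Condition (a) applies at every level outside \<open>jumps u\<close>, hence at almost
  every level, and Fatou's lemma integrates the resulting bounds.\<close>

lemma liminf_inequality:
  assumes conv: "L1_converges \<Omega> un u"
  shows "coarea_integral \<Omega> Jt u \<le> liminf (\<lambda>n. Jn n (un n))"
proof -
  have u: "u \<in> L1 \<Omega>" and un: "\<And>n. un n \<in> L1 \<Omega>" and d: "(\<lambda>n. dist1 (un n) u) \<longlonglongrightarrow> 0"
    using conv by (auto simp: L1_converges_iff)
  define g where "g n s = Jn n (indicator {x\<in>\<Omega>. un n x > s})" for n s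
  \<comment> \<open>When \<open>g n\<close> is not measurable, both \<open>Jn n (un n)\<close> and the integral of the constant \<open>\<infinity>\<close> are
    infinite; this makes Fatou's lemma applicable without passing to a subsequence.\<close>
  define h where "h n = (if g n \<in> borel_measurable lebesgue then g n else (\<lambda>_. \<infinity>))" for n
  have h: "h n \<in> borel_measurable lebesgue" for n by (simp add: h_def)
  have int_h: "(\<integral>\<^sup>+s. h n s \<partial>lebesgue) = Jn n (un n)" for n
  proof -
    have "Jn n (un n) = coarea_integral \<Omega> (Jn n) (un n)" using Jn_GC un by (simp add: GC_def)
    also have "\<dots> = (\<integral>\<^sup>+s. h n s \<partial>lebesgue)"
      by (auto simp: coarea_integral_def h_def g_def[abs_def] ennreal_top_mult)
    finally show ?thesis by simp
  qed
  have "Jt (indicator {x\<in>\<Omega>. u x > s}) \<le> liminf (\<lambda>n. h n s)" if "s \<notin> jumps u" for s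
  proof -
    have null: "measure M {x\<in>\<Omega>. u x = s} = 0" using that by (simp add: jumps_def)
    have "(\<lambda>n. dist1 (indicator {x\<in>\<Omega>. un n x > s}) (indicator {x\<in>\<Omega>. u x > s})) \<longlonglongrightarrow> 0"
    proof (rule order_tendstoI)
      fix a :: real assume "0 < a"
      from dist1_superlevel_small[OF u null this] obtain \<eta> where \<eta>: "\<eta> > 0"
        "\<And>w. w \<in> L1 \<Omega> \<Longrightarrow> dist1 w u < \<eta> \<Longrightarrow>
          dist1 (indicator {x\<in>\<Omega>. w x > s}) (indicator {x\<in>\<Omega>. u x > s}) < a" by blast
      from order_tendstoD(2)[OF d \<eta>(1)]
      show "\<forall>\<^sub>F n in sequentially. dist1 (indicator {x\<in>\<Omega>. un n x > s}) (indicator {x\<in>\<Omega>. u x > s}) < a"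
        by eventually_elim (rule \<eta>(2)[OF un])
    next
      fix a :: real assume "a < 0"
      then show "\<forall>\<^sub>F n in sequentially. a < dist1 (indicator {x\<in>\<Omega>. un n x > s}) (indicator {x\<in>\<Omega>. u x > s})"
        by (intro always_eventually allI) (meson dist1_nonneg less_le_trans)
    qed
    then have "Jt (indicator {x\<in>\<Omega>. u x > s}) \<le> liminf (\<lambda>n. g n s)"
      unfolding g_def by (intro liminf_setsD superlevel_sets u un)
    also have "\<dots> \<le> liminf (\<lambda>n. h n s)"
      by (intro Liminf_mono always_eventually allI) (simp add: h_def)
    finally show ?thesis .
  qed
  then have "AE s in lebesgue. Jt (indicator {x\<in>\<Omega>. u x > s}) \<le> liminf (\<lambda>n. h n s)"
    using AE_not_jumps[OF u] by (auto elim: eventually_mono)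
  then have "coarea_integral \<Omega> Jt u \<le> (\<integral>\<^sup>+s. liminf (\<lambda>n. h n s) \<partial>lebesgue)"
    unfolding coarea_eq[OF u] by (rule nn_integral_mono_AE)
  also have "\<dots> \<le> liminf (\<lambda>n. \<integral>\<^sup>+s. h n s \<partial>lebesgue)"
    using h by (rule nn_integral_liminf)
  finally show ?thesis by (simp add: int_h)
qed

section \<open>Staircases and the limsup inequality\<close>

text \<open>Dominated convergence: the error is at most the modulus of \<open>u\<close> and vanishes
  at each point once \<open>m\<close> is large. Positivity of \<open>m\<close> is kept because it
  later gives the slices positive width.\<close>

lemma truncation_close:
  assumes u: "u \<in> L1 \<Omega>" and "e > 0"
  shows "\<exists>m::nat. m > 0 \<and> dist1 (\<lambda>x. max (- real m) (min (real m) (u x))) u < e"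
proof -
  have [measurable]: "u \<in> borel_measurable M" using u by (rule measurable_L1)
  let ?w = "\<lambda>(m::nat) x. max (- real m) (min (real m) (u x))"
  have "(\<lambda>m. \<integral>x. \<bar>?w m x - u x\<bar> \<partial>M) \<longlonglongrightarrow> (\<integral>x. 0 \<partial>M)"
  proof (rule integral_dominated_convergence[where w="\<lambda>x. \<bar>u x\<bar>"])
    show "AE x in M. (\<lambda>m. \<bar>?w m x - u x\<bar>) \<longlonglongrightarrow> 0"
    proof (rule AE_I2, rule tendsto_eventually)
      fix x
      obtain N :: nat where "\<bar>u x\<bar> < real N" using reals_Archimedean2 by blast
      then have "\<bar>?w m x - u x\<bar> = 0" if "m \<ge> N" for m using that by (auto simp: abs_less_iff)
      then show "\<forall>\<^sub>F m in sequentially. \<bar>?w m x - u x\<bar> = 0"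
        unfolding eventually_sequentially by blast
    qed
  qed (use u in \<open>auto simp: L1_iff intro!: AE_I2\<close>)
  then have "(\<lambda>m. dist1 (?w m) u) \<longlonglongrightarrow> 0" by (simp add: dist1_def)
  then have "\<forall>\<^sub>F m in sequentially. dist1 (?w m) u < e" using \<open>e > 0\<close> by (rule order_tendstoD(2))
  then obtain N where "\<And>m. m \<ge> N \<Longrightarrow> dist1 (?w m) u < e" unfolding eventually_sequentially by blast
  from this[of "Suc N"] show ?thesis by (intro exI[of _ "Suc N"]) simp
qed

lemma staircase_L1:
  "(\<And>i. i < K \<Longrightarrow> f i \<in> L1 \<Omega>) \<Longrightarrow> (\<lambda>x. a + (\<Sum>i<K. \<delta> * f i x)) \<in> L1 \<Omega>" for K :: nat
  unfolding L1_iff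
  by (intro Bochner_Integration.integrable_add Bochner_Integration.integrable_sum) auto

lemma dist1_staircase_le:
  fixes K :: nat
  assumes "\<And>i. i < K \<Longrightarrow> f i \<in> L1 \<Omega>" "\<And>i. i < K \<Longrightarrow> h i \<in> L1 \<Omega>" "\<delta> > 0"
  shows "dist1 (\<lambda>x. a + (\<Sum>i<K. \<delta> * f i x)) (\<lambda>x. a + (\<Sum>i<K. \<delta> * h i x)) \<le> (\<Sum>i<K. \<delta> * dist1 (f i) (h i))"
proof -
  have int: "integrable M (\<lambda>x. \<delta> * \<bar>f i x - h i x\<bar>)" if "i < K" for i
    using assms that by (simp add: L1_iff)
  have "dist1 (\<lambda>x. a + (\<Sum>i<K. \<delta> * f i x)) (\<lambda>x. a + (\<Sum>i<K. \<delta> * h i x))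
      \<le> (\<integral>x. (\<Sum>i<K. \<delta> * \<bar>f i x - h i x\<bar>) \<partial>M)"
  proof (rule dist1_mono)
    show "integrable M (\<lambda>x. \<Sum>i<K. \<delta> * \<bar>f i x - h i x\<bar>)"
      using int by (intro Bochner_Integration.integrable_sum) auto
    fix x
    have "\<bar>\<Sum>i<K. \<delta> * (f i x - h i x)\<bar> \<le> (\<Sum>i<K. \<bar>\<delta> * (f i x - h i x)\<bar>)" by (rule sum_abs)
    then show "\<bar>a + (\<Sum>i<K. \<delta> * f i x) - (a + (\<Sum>i<K. \<delta> * h i x))\<bar> \<le> (\<Sum>i<K. \<delta> * \<bar>f i x - h i x\<bar>)"
      using assms(3) by (simp add: sum_subtractf[symmetric] right_diff_distrib[symmetric] abs_mult)
  qed
  also have "\<dots> = (\<Sum>i<K. \<delta> * dist1 (f i) (h i))"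
    using int by (subst Bochner_Integration.integral_sum) (auto simp: dist1_def)
  finally show ?thesis .
qed

text \<open>Recovery sequences of the finitely many sets are added with weight \<delta>. Convexity
  enters through \<open>GC_sum_le\<close>, which bounds the energy of the sum by the weighted sum of
  the energies.\<close>

lemma staircase_recovery:
  fixes K :: nat
  assumes convex: "\<And>n. convex_functional \<Omega> (Jn n)"
    and E: "\<And>i. i < K \<Longrightarrow> E i \<in> sets M" and "K > 0" "\<delta> > 0" "e > 0"
    and B: "(\<Sum>i<K. ennreal \<delta> * Jt (indicator (E i))) \<le> B"
  shows "\<exists>x. (\<forall>n. x n \<in> L1 \<Omega>) \<and> (\<forall>\<^sub>F n in sequentially.
    dist1 (x n) (\<lambda>x. a + (\<Sum>i<K. \<delta> * indicator (E i) x)) < e \<and> Jn n (x n) \<le> B + ennreal e)"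
proof -
  define R where "R i En \<longleftrightarrow> (\<forall>n. En n \<in> sets M) \<and>
    (\<lambda>n. dist1 (indicator (En n)) (indicator (E i))) \<longlonglongrightarrow> 0 \<and>
    limsup (\<lambda>n. Jn n (indicator (En n))) \<le> Jt (indicator (E i))" for i En
  have "\<forall>i\<in>{..<K}. \<exists>En. R i En"
  proof
    fix i assume "i \<in> {..<K}"
    then have "E i \<in> sets M" using E by simp
    then show "\<exists>En. R i En" unfolding R_def by (rule recovery_setsD) blast
  qed
  then obtain En where "\<forall>i\<in>{..<K}. R i (En i)" by (rule bchoice[THEN exE])
  then have En: "\<And>i n. i < K \<Longrightarrow> En i n \<in> sets M"
    "\<And>i. i < K \<Longrightarrow> (\<lambda>n. dist1 (indicator (En i n)) (indicator (E i))) \<longlonglongrightarrow> 0"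
    "\<And>i. i < K \<Longrightarrow> limsup (\<lambda>n. Jn n (indicator (En i n))) \<le> Jt (indicator (E i))"
    by (simp_all add: R_def)
  \<comment> \<open>Each of the \<open>K\<close> energies may exceed its limit bound by \<epsilon>;
    with weight \<delta> these excesses add up to exactly \<open>e\<close>.\<close>
  define \<epsilon> where "\<epsilon> = e / (real K * \<delta>)"
  have \<epsilon>: "\<epsilon> > 0" "real K * (\<delta> * \<epsilon>) = e" using assms(3-5) by (auto simp: \<epsilon>_def)
  define x where "x n = (\<lambda>x. a + (\<Sum>i<K. \<delta> * indicator (En i n) x))" for n
  have "(\<lambda>n. \<Sum>i<K. \<delta> * dist1 (indicator (En i n)) (indicator (E i))) \<longlonglongrightarrow> (\<Sum>i<K. \<delta> * 0)"
    by (intro tendsto_sum tendsto_mult_left En(2)) simp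
  then have "\<forall>\<^sub>F n in sequentially. (\<Sum>i<K. \<delta> * dist1 (indicator (En i n)) (indicator (E i))) < e"
    using \<open>e > 0\<close> by (intro order_tendstoD(2)) auto
  moreover have "\<forall>\<^sub>F n in sequentially. \<forall>i\<in>{..<K}. Jn n (indicator (En i n)) \<le> Jt (indicator (E i)) + ennreal \<epsilon>"
    by (intro eventually_ball_finite ballI eventually_le_limsup_plus En(3) \<epsilon>(1)) auto
  ultimately have "\<forall>\<^sub>F n in sequentially. dist1 (x n) (\<lambda>x. a + (\<Sum>i<K. \<delta> * indicator (E i) x)) < e \<and>
    Jn n (x n) \<le> B + ennreal e"
  proof eventually_elim
    case (elim n)
    have "dist1 (x n) (\<lambda>x. a + (\<Sum>i<K. \<delta> * indicator (E i) x)) < e"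
      using dist1_staircase_le[of K "\<lambda>i. indicator (En i n)" "\<lambda>i. indicator (E i)" \<delta> a]
        En(1) E indicator_L1 \<open>\<delta> > 0\<close> elim(1) unfolding x_def by fastforce
    moreover have "Jn n (x n) \<le> B + ennreal e"
    proof -
      have "Jn n (x n) \<le> (\<Sum>i<K. ennreal \<delta> * Jn n (indicator (En i n)))"
        unfolding x_def using Jn_GC convex En(1) indicator_L1 assms(3,4) by (intro GC_sum_le) auto
      also have "\<dots> \<le> (\<Sum>i<K. ennreal \<delta> * (Jt (indicator (E i)) + ennreal \<epsilon>))"
        using elim(2) by (intro sum_mono mult_left_mono) auto
      also have "\<dots> = (\<Sum>i<K. ennreal \<delta> * Jt (indicator (E i))) + of_nat K * (ennreal \<delta> * ennreal \<epsilon>)"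
        by (simp add: distrib_left sum.distrib)
      also have "of_nat K * (ennreal \<delta> * ennreal \<epsilon>) = ennreal e"
        using \<epsilon> assms(4) by (simp add: ennreal_of_nat_eq_real_of_nat ennreal_mult[symmetric])
      finally show ?thesis using B by (meson add_right_mono order_trans)
    qed
    ultimately show ?case ..
  qed
  moreover have "x n \<in> L1 \<Omega>" for n
    unfolding x_def using En(1) indicator_L1 by (intro staircase_L1) auto
  ultimately show ?thesis by blast
qed

text \<open>One third of the distance goes to each of truncation, staircase and recovery of the
  staircase. The levels are chosen so that the staircase energy is at most the coarea integral of
  \<open>u\<close>.\<close>

lemma limsup_inequality:
  assumes convex: "\<And>n. convex_functional \<Omega> (Jn n)" and u: "u \<in> L1 \<Omega>"
  shows "\<exists>un. L1_converges \<Omega> un u \<and> limsup (\<lambda>n. Jn n (un n)) \<le> coarea_integral \<Omega> Jt u"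
proof -
  have "\<exists>un. (\<forall>n. un n \<in> L1 \<Omega>) \<and> L1_converges \<Omega> un u \<and> limsup (\<lambda>n. Jn n (un n)) \<le> coarea_integral \<Omega> Jt u"
  proof (rule recovery_from_approximations[OF u subset_refl])
    fix e :: real assume "e > 0"
    obtain m :: nat where m: "m > 0" "dist1 (\<lambda>x. max (- real m) (min (real m) (u x))) u < e / 3"
      using truncation_close[OF u, of "e / 3"] \<open>e > 0\<close> by auto
    define w where "w x = max (- real m) (min (real m) (u x))" for x
    have w: "w \<in> L1 \<Omega>"
      using u unfolding w_def[abs_def] L1_iff by (intro integrable_max integrable_min) auto
    \<comment> \<open>Enough slices of [-m, m] are taken for their width \<delta> times the measure
      of \<Omega> to be below \<open>e / 3\<close>; the successor makes positivity of
      \<open>K\<close> immediate.\<close>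
    obtain K0 :: nat where K0: "2 * real m * measure M \<Omega> * 3 / e < real K0"
      using reals_Archimedean2 by blast
    define K where "K = Suc K0"
    define \<delta> where "\<delta> = 2 * real m / real K"
    have \<delta>: "\<delta> > 0" "real K * \<delta> = 2 * real m" using m(1) by (auto simp: \<delta>_def K_def)
    have "2 * real m * measure M \<Omega> * 3 / e < real K" using K0 by (simp add: K_def)
    then have \<delta>small: "\<delta> * measure M \<Omega> < e / 3"
      using \<open>e > 0\<close> by (simp add: \<delta>_def field_simps K_def)
    obtain s where s: "\<And>i. i < K \<Longrightarrow> - real m + real i * \<delta> < s i \<and> s i < - real m + real (Suc i) * \<delta>"
      "(\<Sum>i<K. ennreal \<delta> * Jt (indicator {x\<in>\<Omega>. u x > s i})) \<le> coarea_integral \<Omega> Jt u"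
      using exists_slice_levels[OF measurable_level[OF u] \<delta>(1), of K "- real m"]
      unfolding coarea_eq[OF u] by blast
    define v where "v x = - real m + (\<Sum>i<K. \<delta> * indicator {x\<in>\<Omega>. u x > s i} x)" for x
    have v: "v \<in> L1 \<Omega>"
      unfolding v_def[abs_def] by (intro staircase_L1 indicator_L1 superlevel_sets u)
    have "dist1 v w \<le> (\<integral>x. \<delta> \<partial>M)"
    proof (rule dist1_mono)
      fix x assume "x \<in> \<Omega>"
      \<comment> \<open>All levels lie strictly between -m and m, where truncation does not affect
        whether a value exceeds the level. So a staircase built from superlevel sets of
        \<open>u\<close> approximates \<open>w\<close>.\<close>
      have "indicator {x\<in>\<Omega>. u x > s i} x = (if s i < w x then 1 else (0::real))" if "i < K" for i
      proof -
        have "real (Suc i) * \<delta> \<le> real K * \<delta>" using that \<delta>(1) by (intro mult_right_mono) auto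
        moreover have "0 \<le> real i * \<delta>" using \<delta>(1) by simp
        ultimately have "- real m < s i" "s i < real m" using s(1)[OF that] \<delta>(2) by linarith+
        with \<open>x \<in> \<Omega>\<close> show ?thesis by (auto simp: w_def)
      qed
      then have "v x = - real m + (\<Sum>i<K. \<delta> * (if s i < w x then 1 else 0))"
        unfolding v_def by simp
      also have "\<bar>\<dots> - w x\<bar> \<le> \<delta>"
        using s(1) \<delta> by (intro staircase_approx) (auto simp: w_def)
      finally show "\<bar>v x - w x\<bar> \<le> \<delta>" .
    qed simp
    then have vw: "dist1 v w < e / 3" using \<delta>small by (simp add: mult.commute)
    have "\<exists>x. (\<forall>n. x n \<in> L1 \<Omega>) \<and> (\<forall>\<^sub>F n in sequentially.
        dist1 (x n) v < e / 3 \<and> Jn n (x n) \<le> coarea_integral \<Omega> Jt u + ennreal (e / 3))"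
      unfolding v_def[abs_def]
      by (rule staircase_recovery[OF convex superlevel_sets[OF u] _ \<delta>(1) _ s(2)])
        (use \<open>e > 0\<close> in \<open>auto simp: K_def\<close>)
    then obtain x where x: "\<And>n. x n \<in> L1 \<Omega>" "\<forall>\<^sub>F n in sequentially.
        dist1 (x n) v < e / 3 \<and> Jn n (x n) \<le> coarea_integral \<Omega> Jt u + ennreal (e / 3)" by blast
    from x(2) have "\<forall>\<^sub>F n in sequentially.
        dist1 (x n) u < e \<and> Jn n (x n) \<le> coarea_integral \<Omega> Jt u + ennreal e"
    proof eventually_elim
      case (elim n)
      have "dist1 (x n) u \<le> dist1 (x n) v + (dist1 v w + dist1 w u)"
        using dist1_triangle[OF x(1)[of n] v u] dist1_triangle[OF v w u] by simp
      moreover have "coarea_integral \<Omega> Jt u + ennreal (e / 3) \<le> coarea_integral \<Omega> Jt u + ennreal e"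
        using \<open>e > 0\<close> by (intro add_left_mono ennreal_leI) simp
      moreover have "dist1 w u < e / 3" using m(2) by (simp add: w_def[abs_def])
      ultimately show ?case using elim vw order_trans by fastforce
    qed
    with x(1) show "\<exists>x. (\<forall>n. x n \<in> L1 \<Omega>) \<and> (\<forall>\<^sub>F n in sequentially.
        dist1 (x n) u < e \<and> Jn n (x n) \<le> coarea_integral \<Omega> Jt u + ennreal e)" by blast
  qed
  then show ?thesis by blast
qed

lemma Gamma_converges_coarea:
  "(\<And>n. convex_functional \<Omega> (Jn n)) \<Longrightarrow> Gamma_converges \<Omega> Jn (coarea_integral \<Omega> Jt)"
  unfolding Gamma_converges_def using liminf_inequality limsup_inequality by blast

end

section \<open>Uniqueness of the limit and conclusion\<close>

text \<open>The liminf inequality for \<open>J\<close> is tested on a recovery sequence for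
  \<open>J'\<close>. Exchanging the roles gives uniqueness of the limit.\<close>

lemma Gamma_limit_le:
  assumes "Gamma_converges \<Omega> Jn J" "Gamma_converges \<Omega> Jn J'" "u \<in> L1 \<Omega>"
  shows "J u \<le> J' u"
proof -
  obtain un where un: "L1_converges \<Omega> un u" "limsup (\<lambda>n. Jn n (un n)) \<le> J' u"
    using assms(2,3) unfolding Gamma_converges_def by blast
  have "J u \<le> liminf (\<lambda>n. Jn n (un n))"
    using assms(1,3) un(1) unfolding Gamma_converges_def by blast
  also have "\<dots> \<le> limsup (\<lambda>n. Jn n (un n))" by (simp add: Liminf_le_Limsup)
  finally show ?thesis using un(2) by simp
qed

theorem proposition3p5:
  fixes \<Omega> :: "(real ^ 'n) set"
  assumes "open \<Omega>" and "bounded \<Omega>"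
  shows "(\<forall>(Jn :: nat \<Rightarrow> (real ^ 'n \<Rightarrow> real) \<Rightarrow> ennreal) Jt.
            (\<forall>n. Jn n \<in> GC \<Omega> \<and> convex_functional \<Omega> (Jn n)) \<and>
            liminf_on_sets \<Omega> Jn Jt \<and> recovery_on_sets \<Omega> Jn Jt \<longrightarrow>
            coarea_integral \<Omega> Jt \<in> GC \<Omega> \<and>
            Gamma_converges \<Omega> Jn (coarea_integral \<Omega> Jt)) \<and>
         (\<forall>(Jn :: nat \<Rightarrow> (real ^ 'n \<Rightarrow> real) \<Rightarrow> ennreal) J.
            (\<forall>n. Jn n \<in> GC \<Omega>) \<and>
            L1_functional \<Omega> J \<and> proper_functional \<Omega> J \<and> Gamma_converges \<Omega> Jn J \<longrightarrow>
            ((\<forall>n. convex_functional \<Omega> (Jn n)) \<longrightarrow> J \<in> GC \<Omega>) \<and>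
            liminf_on_sets \<Omega> Jn J \<and> recovery_on_sets \<Omega> Jn J)"
proof -
  interpret bounded_open_set \<Omega> using assms by unfold_locales
  have part1: "coarea_integral \<Omega> Jt \<in> GC \<Omega> \<and> Gamma_converges \<Omega> Jn (coarea_integral \<Omega> Jt)"
    if "\<And>n. Jn n \<in> GC \<Omega>" "\<And>n. convex_functional \<Omega> (Jn n)"
      "liminf_on_sets \<Omega> Jn Jt" "recovery_on_sets \<Omega> Jn Jt"
    for Jn :: "nat \<Rightarrow> (real ^ 'n \<Rightarrow> real) \<Rightarrow> ennreal" and Jt
  proof -
    interpret set_limit \<Omega> Jn Jt using that by unfold_locales
    show ?thesis using coarea_GC Gamma_converges_coarea that(2) by blast
  qed
  have part2: "((\<forall>n. convex_functional \<Omega> (Jn n)) \<longrightarrow> J \<in> GC \<Omega>) \<and>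
      liminf_on_sets \<Omega> Jn J \<and> recovery_on_sets \<Omega> Jn J"
    if GC: "\<And>n. Jn n \<in> GC \<Omega>" and J: "L1_functional \<Omega> J" "proper_functional \<Omega> J"
      and Gamma: "Gamma_converges \<Omega> Jn J"
    for Jn :: "nat \<Rightarrow> (real ^ 'n \<Rightarrow> real) \<Rightarrow> ennreal" and J
  proof -
    have liminf: "liminf_on_sets \<Omega> Jn J"
      unfolding liminf_on_sets_def using Gamma indicator_L1 unfolding Gamma_converges_def sets_M by blast
    have recovery: "recovery_on_sets \<Omega> Jn J"
      unfolding recovery_on_sets_def
    proof (intro allI impI)
      fix E assume "E \<in> sets borel \<and> E \<subseteq> \<Omega>"
      then have E: "E \<in> sets M" by (simp add: sets_M)
      then obtain un where "L1_converges \<Omega> un (indicator E)" "limsup (\<lambda>n. Jn n (un n)) \<le> J (indicator E)"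
        using Gamma indicator_L1 unfolding Gamma_converges_def by blast
      from GC_recovery_on_sets[OF GC E this]
      show "\<exists>En. (\<forall>n. En n \<in> sets borel \<and> En n \<subseteq> \<Omega>) \<and>
          L1_converges \<Omega> (\<lambda>n. indicator (En n)) (indicator E) \<and>
          limsup (\<lambda>n. Jn n (indicator (En n))) \<le> J (indicator E)"
        unfolding sets_M .
    qed
    \<comment> \<open>Conditions (a) and (b) for \<open>J\<close> are now available, so the first
      part, with \<open>J\<close> as the functional on sets, yields a second limit of the same
      sequence. Convexity is assumed here because the first part is applied.\<close>
    have "J \<in> GC \<Omega>" if "\<forall>n. convex_functional \<Omega> (Jn n)"
    proof -
      have "Gamma_converges \<Omega> Jn (coarea_integral \<Omega> J)"
        using part1[of Jn J] GC that liminf recovery by blast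
      then have "J u = coarea_integral \<Omega> J u" if "u \<in> L1 \<Omega>" for u
        using Gamma_limit_le Gamma that by (metis antisym)
      with J show ?thesis by (simp add: GC_def)
    qed
    with liminf recovery show ?thesis by blast
  qed
  show ?thesis using part1 part2 by blast
qed

end
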